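(* Let $(X,d)$ be an infinite compact metric space and let $\alpha\in(0,1]$. Then the little Lipschitz algebra $\operatorname{lip}_\alpha(X,d)$ is not approximately amenable.
   Context: For $f\in C(X)$ (complex-valued continuous functions) and $x\ne y$ in $X$ put $\Delta f(x,y)=d(x,y)^{-\alpha}[f(x)-f(y)]$ and $p_\alpha(f)=\sup_{x\neq y}|\Delta f(x,y)|$. $\operatorname{Lip}_\alpha(X,d)$ is the space of all $f\in C(X)$ with $p_\alpha(f)<\infty$, with norm $\|f\|_\alpha=\|f\|_\infty+p_\alpha(f)$; $\operatorname{lip}_\alpha(X,d)$ is the closed subspace of those $f$ in it such that $\Delta f(x,y)\to0$ as $d(x,y)\to0$. With pointwise product and the norm $\|\cdot\|_\alpha$, $\operatorname{lip}_\alpha(X,d)$ is a unital commutative Banach algebra. A continuous derivation $D$ from a Banach algebra $\mathcal{A}$ into a Banach $\mathcal{A}$-bimodule $Y$ is approximately inner if there is a net $(y_i)$ in $Y$ such that $D(a)=\lim_i (a\cdot y_i-y_i\cdot a)$ in norm for every $a\in\mathcal{A}$. The Banach algebra $\mathcal{A}$ is approximately amenable if, for every Banach $\mathcal{A}$-bimodule $Z$, every continuous derivation from $\mathcal{A}$ into the dual bimodule $Z^*$ is approximately inner.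
   Formalization: For α = 1 it is additionally assumed that lip_1(X,d) is infinite-dimensional; without this the claim fails (for X = [0,1], lip_1 consists of the constants, so it is ℂ, which is amenable). For 0 < α < 1 nothing is added. *)

theory Defs
  imports "HOL-Analysis.Analysis" "HOL-Algebra.Module"
begin

section \<open>Normed spaces, Banach bimodules and their duals\<close>

definition complex_ring :: "complex ring" where
  "complex_ring = \<lparr>carrier = UNIV, mult = (*), one = 1, zero = 0, add = (+)\<rparr>"

text \<open>
  Complex normed spaces and algebras are carried by sets, since the bimodules below have to be
  quantified over. As in HOL-Algebra, a module record also has fields for a product and a unit;
  these are relevant only when the record stands for an algebra.
\<close>

record 'b normed_module = "(complex, 'b) module" +
  nrm :: "'b \<Rightarrow> real"

definition normed_space :: "('b, 'm) normed_module_scheme \<Rightarrow> bool" where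
  "normed_space V \<longleftrightarrow> Module.module complex_ring V \<and>
     (\<forall>x \<in> carrier V. 0 \<le> nrm V x) \<and>
     (\<forall>x \<in> carrier V. nrm V x = 0 \<longleftrightarrow> x = \<zero>\<^bsub>V\<^esub>) \<and>
     (\<forall>c. \<forall>x \<in> carrier V. nrm V (c \<odot>\<^bsub>V\<^esub> x) = cmod c * nrm V x) \<and>
     (\<forall>x \<in> carrier V. \<forall>y \<in> carrier V. nrm V (x \<oplus>\<^bsub>V\<^esub> y) \<le> nrm V x + nrm V y)"

definition banach_space :: "('b, 'm) normed_module_scheme \<Rightarrow> bool" where
  "banach_space V \<longleftrightarrow> normed_space V \<and>
     (\<forall>s :: nat \<Rightarrow> 'b. range s \<subseteq> carrier V \<and>
         (\<forall>\<epsilon>>0. \<exists>N. \<forall>m\<ge>N. \<forall>n\<ge>N. nrm V (s m \<ominus>\<^bsub>V\<^esub> s n) < \<epsilon>) \<longrightarrow>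
       (\<exists>l \<in> carrier V. (\<lambda>n. nrm V (s n \<ominus>\<^bsub>V\<^esub> l)) \<longlonglongrightarrow> 0))"

text \<open>For linear maps of normed spaces, continuity is rendered as boundedness.\<close>

definition bounded_linear_map ::
    "('b, 'm) normed_module_scheme \<Rightarrow> ('c, 'n) normed_module_scheme \<Rightarrow> ('b \<Rightarrow> 'c) \<Rightarrow> bool" where
  "bounded_linear_map V W T \<longleftrightarrow> T \<in> carrier V \<rightarrow> carrier W \<and>
     (\<forall>x \<in> carrier V. \<forall>y \<in> carrier V. T (x \<oplus>\<^bsub>V\<^esub> y) = T x \<oplus>\<^bsub>W\<^esub> T y) \<and>
     (\<forall>c. \<forall>x \<in> carrier V. T (c \<odot>\<^bsub>V\<^esub> x) = c \<odot>\<^bsub>W\<^esub> T x) \<and>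
     (\<exists>C. \<forall>x \<in> carrier V. nrm W (T x) \<le> C * nrm V x)"

record ('b, 'z) bimodule = "'z normed_module" +
  lact :: "'b \<Rightarrow> 'z \<Rightarrow> 'z"
  ract :: "'z \<Rightarrow> 'b \<Rightarrow> 'z"

text \<open>
  The module actions are bounded with some constant, and a unit of the algebra (if there is one)
  is not required to act as the identity.
\<close>

definition banach_bimodule ::
    "('b, 'm) normed_module_scheme \<Rightarrow> ('b, 'z, 'n) bimodule_scheme \<Rightarrow> bool" where
  "banach_bimodule A Z \<longleftrightarrow> banach_space Z \<and>
     (\<forall>a \<in> carrier A. \<forall>z \<in> carrier Z. lact Z a z \<in> carrier Z \<and> ract Z z a \<in> carrier Z) \<and>
     (\<forall>a \<in> carrier A. \<forall>z \<in> carrier Z. \<forall>w \<in> carrier Z.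
         lact Z a (z \<oplus>\<^bsub>Z\<^esub> w) = lact Z a z \<oplus>\<^bsub>Z\<^esub> lact Z a w \<and>
         ract Z (z \<oplus>\<^bsub>Z\<^esub> w) a = ract Z z a \<oplus>\<^bsub>Z\<^esub> ract Z w a) \<and>
     (\<forall>a \<in> carrier A. \<forall>b \<in> carrier A. \<forall>z \<in> carrier Z.
         lact Z (a \<oplus>\<^bsub>A\<^esub> b) z = lact Z a z \<oplus>\<^bsub>Z\<^esub> lact Z b z \<and>
         ract Z z (a \<oplus>\<^bsub>A\<^esub> b) = ract Z z a \<oplus>\<^bsub>Z\<^esub> ract Z z b) \<and>
     (\<forall>c. \<forall>a \<in> carrier A. \<forall>z \<in> carrier Z.
         lact Z (c \<odot>\<^bsub>A\<^esub> a) z = c \<odot>\<^bsub>Z\<^esub> lact Z a z \<and>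
         lact Z a (c \<odot>\<^bsub>Z\<^esub> z) = c \<odot>\<^bsub>Z\<^esub> lact Z a z \<and>
         ract Z z (c \<odot>\<^bsub>A\<^esub> a) = c \<odot>\<^bsub>Z\<^esub> ract Z z a \<and>
         ract Z (c \<odot>\<^bsub>Z\<^esub> z) a = c \<odot>\<^bsub>Z\<^esub> ract Z z a) \<and>
     (\<forall>a \<in> carrier A. \<forall>b \<in> carrier A. \<forall>z \<in> carrier Z.
         lact Z (a \<otimes>\<^bsub>A\<^esub> b) z = lact Z a (lact Z b z) \<and>
         ract Z z (a \<otimes>\<^bsub>A\<^esub> b) = ract Z (ract Z z a) b \<and>
         ract Z (lact Z a z) b = lact Z a (ract Z z b)) \<and>
     (\<exists>C. \<forall>a \<in> carrier A. \<forall>z \<in> carrier Z.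
         nrm Z (lact Z a z) \<le> C * nrm A a * nrm Z z \<and>
         nrm Z (ract Z z a) \<le> C * nrm A a * nrm Z z)"

text \<open>
  The dual bimodule, with \<open>(a \<cdot> \<phi>)(z) = \<phi>(z \<cdot> a)\<close> and \<open>(\<phi> \<cdot> a)(z) = \<phi>(a \<cdot> z)\<close>. Functionals are
  extensional outside the carrier, so that equal functionals are equal as functions.
\<close>

definition dual_bimodule :: "('b, 'z, 'n) bimodule_scheme \<Rightarrow> ('b, 'z \<Rightarrow> complex) bimodule" where
  "dual_bimodule Z =
     \<lparr>carrier = {\<phi> \<in> extensional (carrier Z).
          (\<forall>z \<in> carrier Z. \<forall>w \<in> carrier Z. \<phi> (z \<oplus>\<^bsub>Z\<^esub> w) = \<phi> z + \<phi> w) \<and>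
          (\<forall>c. \<forall>z \<in> carrier Z. \<phi> (c \<odot>\<^bsub>Z\<^esub> z) = c * \<phi> z) \<and>
          (\<exists>C. \<forall>z \<in> carrier Z. cmod (\<phi> z) \<le> C * nrm Z z)},
      mult = undefined, one = undefined,
      zero = (\<lambda>z \<in> carrier Z. 0),
      add = (\<lambda>\<phi> \<psi>. \<lambda>z \<in> carrier Z. \<phi> z + \<psi> z),
      smult = (\<lambda>c \<phi>. \<lambda>z \<in> carrier Z. c * \<phi> z),
      nrm = (\<lambda>\<phi>. SUP z \<in> {z \<in> carrier Z. nrm Z z \<le> 1}. cmod (\<phi> z)),
      lact = (\<lambda>a \<phi>. \<lambda>z \<in> carrier Z. \<phi> (ract Z z a)),
      ract = (\<lambda>\<phi> a. \<lambda>z \<in> carrier Z. \<phi> (lact Z a z))\<rparr>"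


section \<open>Approximate amenability\<close>

definition continuous_derivation ::
    "('b, 'm) normed_module_scheme \<Rightarrow> ('b, 'y, 'n) bimodule_scheme \<Rightarrow> ('b \<Rightarrow> 'y) \<Rightarrow> bool" where
  "continuous_derivation A Y D \<longleftrightarrow> bounded_linear_map A Y D \<and>
     (\<forall>a \<in> carrier A. \<forall>b \<in> carrier A.
         D (a \<otimes>\<^bsub>A\<^esub> b) = lact Y a (D b) \<oplus>\<^bsub>Y\<^esub> ract Y (D a) b)"

text \<open>
  Nets in \<open>Y\<close> are rendered as proper filters on \<open>Y\<close>: a net gives its filter of eventual sets, and
  a proper filter \<open>F\<close> is the filter of eventual sets of the net \<open>(y, S) \<mapsto> y\<close>, where \<open>y \<in> S \<in> F\<close>
  and the index pairs are ordered by reverse inclusion of \<open>S\<close>.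
\<close>

definition approximately_inner ::
    "('b, 'm) normed_module_scheme \<Rightarrow> ('b, 'y, 'n) bimodule_scheme \<Rightarrow> ('b \<Rightarrow> 'y) \<Rightarrow> bool" where
  "approximately_inner A Y D \<longleftrightarrow>
     (\<exists>F :: 'y filter. F \<noteq> bot \<and> (\<forall>\<^sub>F y in F. y \<in> carrier Y) \<and>
        (\<forall>a \<in> carrier A.
           ((\<lambda>y. nrm Y (D a \<ominus>\<^bsub>Y\<^esub> (lact Y a y \<ominus>\<^bsub>Y\<^esub> ract Y y a))) \<longlongrightarrow> 0) F))"

text \<open>
  HOL cannot quantify over types inside a formula, so the bimodules \<open>Z\<close> range over all those whose
  carrier is a set of elements of type \<open>'b \<Rightarrow> 'b \<Rightarrow> complex\<close>, where \<open>'b\<close> is the type of the elements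
  of \<open>A\<close>. This universe is large enough for every Banach algebra \<open>A\<close>: let \<open>B\<close> be \<open>A\<close> with a unit
  adjoined and \<open>K\<close> the kernel of the product map on the projective tensor square of \<open>B\<close>. Then \<open>A\<close> is
  approximately amenable iff the single derivation \<open>a \<mapsto> a \<otimes> 1 - 1 \<otimes> a\<close> from \<open>A\<close> into the bidual of
  \<open>K\<close> is approximately inner, and \<open>Z = K\<^sup>*\<close>, a quotient of the space of bounded bilinear forms on
  \<open>B\<close>, has a copy in this type. In any case a failure of approximate amenability in the sense below
  is one in the unrestricted sense.
\<close>

definition approximately_amenable :: "('b, 'm) normed_module_scheme \<Rightarrow> bool" where
  "approximately_amenable A \<longleftrightarrow>
     (\<forall>(Z :: ('b, 'b \<Rightarrow> 'b \<Rightarrow> complex) bimodule) D.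
        banach_bimodule A Z \<longrightarrow> continuous_derivation A (dual_bimodule Z) D \<longrightarrow>
        approximately_inner A (dual_bimodule Z) D)"


section \<open>Lipschitz algebras\<close>

text \<open>The metric space is the whole type \<open>'a\<close>, with metric \<open>dist\<close>.\<close>

definition lip_quotient :: "real \<Rightarrow> ('a::metric_space \<Rightarrow> complex) \<Rightarrow> 'a \<Rightarrow> 'a \<Rightarrow> complex" where
  "lip_quotient \<alpha> f x y = complex_of_real (dist x y powr (- \<alpha>)) * (f x - f y)"

definition lip_seminorm :: "real \<Rightarrow> ('a::metric_space \<Rightarrow> complex) \<Rightarrow> real" where
  "lip_seminorm \<alpha> f = (SUP (x, y) \<in> {(x, y). x \<noteq> y}. cmod (lip_quotient \<alpha> f x y))"

definition big_lip :: "real \<Rightarrow> ('a::metric_space \<Rightarrow> complex) set" where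
  "big_lip \<alpha> = {f. continuous_on UNIV f \<and>
     bdd_above ((\<lambda>(x, y). cmod (lip_quotient \<alpha> f x y)) ` {(x, y). x \<noteq> y})}"

definition little_lip :: "real \<Rightarrow> ('a::metric_space \<Rightarrow> complex) set" where
  "little_lip \<alpha> = {f \<in> big_lip \<alpha>.
     \<forall>\<epsilon>>0. \<exists>\<delta>>0. \<forall>x y. x \<noteq> y \<and> dist x y < \<delta> \<longrightarrow> cmod (lip_quotient \<alpha> f x y) < \<epsilon>}"

definition little_lip_algebra :: "real \<Rightarrow> ('a::metric_space \<Rightarrow> complex) normed_module" where
  "little_lip_algebra \<alpha> =
     \<lparr>carrier = little_lip \<alpha>,
      mult = (\<lambda>f g x. f x * g x), one = (\<lambda>_. 1),
      zero = (\<lambda>_. 0), add = (\<lambda>f g x. f x + g x),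
      smult = (\<lambda>c f x. c * f x),
      nrm = (\<lambda>f. (SUP x. cmod (f x)) + lip_seminorm \<alpha> f)\<rparr>"

text \<open>
  For \<open>\<alpha> < 1\<close> and an infinite space, \<open>little_lip \<alpha>\<close> contains all functions that are Lipschitz for
  \<open>dist\<close> and so has infinite dimension. For \<open>\<alpha> = 1\<close> it can degenerate: on the unit interval it
  consists of the constants, and the resulting algebra \<open>\<complex>\<close> is amenable.
\<close>

definition finite_dimensional :: "('b, 'm) normed_module_scheme \<Rightarrow> bool" where
  "finite_dimensional V \<longleftrightarrow>
     (\<exists>S. finite S \<and> S \<subseteq> carrier V \<and>
        (\<forall>v \<in> carrier V. \<exists>c :: 'b \<Rightarrow> complex. v = (\<Oplus>\<^bsub>V\<^esub>s\<in>S. c s \<odot>\<^bsub>V\<^esub> s)))"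

end

theory Submission
  imports Defs
begin

text \<open>
  Let \<open>A = lip\<^sub>\<alpha>(X, d)\<close>. If \<open>A\<close> is approximately amenable, then its universal derivation, with values in
  the dual of the space of bounded bilinear forms on \<open>A\<close>, is approximately inner. Testing an almost
  implementing functional on point evaluations gives, for finitely many \<open>c \<in> A\<close> and \<open>\<epsilon> > 0\<close>, a function
  \<open>F\<close> on \<open>X \<times> X\<close> such that \<open>(c x - c y) F(x, y)\<close> is small in a norm of projective tensor product type. Fix
  \<open>p\<close> and let \<open>s(x)\<close> be the norm of \<open>h \<mapsto> h x - h p\<close>. If \<open>a\<close> and \<open>b\<close> vanish at \<open>p\<close>, \<open>b x = 0\<close> and
  \<open>a y = 0\<close>, smallness for \<open>c = a\<close> makes \<open>F(x, y)\<close> close to \<open>F(x, p)\<close>, and for \<open>c = b\<close> close to \<open>F(p, y)\<close>.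
  Take points \<open>x\<^sub>n\<close> with \<open>s(x\<^sub>n)\<close> positive and rapidly decreasing, and \<open>a\<close>, \<open>b\<close> supported, among these points,
  on the even and on the odd ones. Then the numbers
  \<open>F(x\<^sub>0, p), F(p, x\<^sub>1), F(x\<^sub>2, p), F(p, x\<^sub>3), \<dots>\<close> have small total variation and start near 0. But they
  tend to \<open>F(p, p) = 1\<close>, because \<open>F - 1\<close> has finite norm and \<open>s(x\<^sub>n)\<close> tends to 0.
\<close>

section \<open>The scalars as a HOL-Algebra ring\<close>

lemma cring_complex_ring: "cring complex_ring"
proof (rule cringI)
  have "\<exists>y. y + x = 0" for x :: complex
    by (rule exI[of _ "- x"]) simp
  then show "abelian_group complex_ring"
    by (intro abelian_groupI) (simp_all add: complex_ring_def)
  show "comm_monoid complex_ring"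
    by (intro comm_monoidI) (simp_all add: complex_ring_def)
qed (simp add: complex_ring_def distrib_right)

lemma complex_ring_simps [simp]:
  "carrier complex_ring = UNIV" "s \<otimes>\<^bsub>complex_ring\<^esub> t = s * t"
  "s \<oplus>\<^bsub>complex_ring\<^esub> t = s + t" "\<one>\<^bsub>complex_ring\<^esub> = 1"
  by (simp_all add: complex_ring_def)

section \<open>Functionals on Banach bimodules\<close>

lemma dual_bimodule_simps [simp]:
  "\<zero>\<^bsub>dual_bimodule Z\<^esub> = (\<lambda>z \<in> carrier Z. 0)"
  "\<phi> \<oplus>\<^bsub>dual_bimodule Z\<^esub> \<psi> = (\<lambda>z \<in> carrier Z. \<phi> z + \<psi> z)"
  "t \<odot>\<^bsub>dual_bimodule Z\<^esub> \<phi> = (\<lambda>z \<in> carrier Z. t * \<phi> z)"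
  "nrm (dual_bimodule Z) \<phi> = (SUP z \<in> {z \<in> carrier Z. nrm Z z \<le> 1}. cmod (\<phi> z))"
  "lact (dual_bimodule Z) a \<phi> = (\<lambda>z \<in> carrier Z. \<phi> (ract Z z a))"
  "ract (dual_bimodule Z) \<phi> a = (\<lambda>z \<in> carrier Z. \<phi> (lact Z a z))"
  by (simp_all add: dual_bimodule_def)

lemma dual_carrier_iff:
  "\<phi> \<in> carrier (dual_bimodule Z) \<longleftrightarrow> \<phi> \<in> extensional (carrier Z) \<and>
     (\<forall>z \<in> carrier Z. \<forall>w \<in> carrier Z. \<phi> (z \<oplus>\<^bsub>Z\<^esub> w) = \<phi> z + \<phi> w) \<and>
     (\<forall>c. \<forall>z \<in> carrier Z. \<phi> (c \<odot>\<^bsub>Z\<^esub> z) = c * \<phi> z) \<and>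
     (\<exists>C. \<forall>z \<in> carrier Z. cmod (\<phi> z) \<le> C * nrm Z z)"
  by (simp add: dual_bimodule_def)

lemma normed_space_closed:
  assumes "normed_space Z"
  shows "\<lbrakk>z \<in> carrier Z; w \<in> carrier Z\<rbrakk> \<Longrightarrow> z \<oplus>\<^bsub>Z\<^esub> w \<in> carrier Z"
    and "z \<in> carrier Z \<Longrightarrow> c \<odot>\<^bsub>Z\<^esub> z \<in> carrier Z"
proof -
  interpret Module.module complex_ring Z
    using assms by (simp add: normed_space_def)
  show "\<lbrakk>z \<in> carrier Z; w \<in> carrier Z\<rbrakk> \<Longrightarrow> z \<oplus>\<^bsub>Z\<^esub> w \<in> carrier Z"
    by simp
  show "z \<in> carrier Z \<Longrightarrow> c \<odot>\<^bsub>Z\<^esub> z \<in> carrier Z"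
    by (rule smult_closed) simp_all
qed

lemma dual_smult_closed:
  assumes "normed_space Z" and "\<phi> \<in> carrier (dual_bimodule Z)"
  shows "(\<lambda>z \<in> carrier Z. c * \<phi> z) \<in> carrier (dual_bimodule Z)"
proof -
  obtain C where C: "\<And>z. z \<in> carrier Z \<Longrightarrow> cmod (\<phi> z) \<le> C * nrm Z z"
    using assms(2) unfolding dual_carrier_iff by blast
  have "cmod (c * \<phi> z) \<le> (cmod c * C) * nrm Z z" if "z \<in> carrier Z" for z
    using C[OF that] by (simp add: norm_mult mult.assoc mult_left_mono)
  then have "\<exists>K. \<forall>z \<in> carrier Z. cmod (c * \<phi> z) \<le> K * nrm Z z"
    by blast
  with assms show ?thesis
    by (simp add: dual_carrier_iff normed_space_closed algebra_simps)
qed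

lemma dual_add_closed:
  assumes "normed_space Z" and "\<phi> \<in> carrier (dual_bimodule Z)" "\<psi> \<in> carrier (dual_bimodule Z)"
  shows "(\<lambda>z \<in> carrier Z. \<phi> z + \<psi> z) \<in> carrier (dual_bimodule Z)"
proof -
  obtain C where C: "\<And>z. z \<in> carrier Z \<Longrightarrow> cmod (\<phi> z) \<le> C * nrm Z z"
    using assms(2) unfolding dual_carrier_iff by blast
  obtain K where K: "\<And>z. z \<in> carrier Z \<Longrightarrow> cmod (\<psi> z) \<le> K * nrm Z z"
    using assms(3) unfolding dual_carrier_iff by blast
  have "cmod (\<phi> z + \<psi> z) \<le> (C + K) * nrm Z z" if "z \<in> carrier Z" for z
    using norm_triangle_ineq[of "\<phi> z" "\<psi> z"] C[OF that] K[OF that] by (simp add: distrib_right)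
  then have "\<exists>K. \<forall>z \<in> carrier Z. cmod (\<phi> z + \<psi> z) \<le> K * nrm Z z"
    by blast
  with assms show ?thesis
    by (simp add: dual_carrier_iff normed_space_closed algebra_simps)
qed

lemma abelian_group_dual:
  assumes "normed_space Z"
  shows "abelian_group (dual_bimodule Z)"
proof (rule abelian_groupI, goal_cases)
  case (6 \<phi>)
  with dual_smult_closed[OF assms 6, of "- 1"] show ?case
    by (intro bexI[of _ "\<lambda>z \<in> carrier Z. - 1 * \<phi> z"]) auto
next
  case 2
  have "\<exists>C. \<forall>z \<in> carrier Z. 0 \<le> C * nrm Z z"
    by (rule exI[of _ 0]) simp
  with assms show ?case
    by (simp add: dual_carrier_iff normed_space_closed)
next
  case (1 \<phi> \<psi>)
  with dual_add_closed[OF assms] show ?case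
    by simp
qed (use assms in \<open>auto simp: normed_space_closed algebra_simps dual_carrier_iff
       extensional_def restrict_def\<close>)

text \<open>\<open>a_minus\<close> goes through the additive inverse, which is only characterised by
  its defining equation, so the pointwise formula rests on the group laws of the dual.\<close>

lemma dual_minus:
  assumes Z: "normed_space Z" and "\<phi> \<in> carrier (dual_bimodule Z)" "\<psi> \<in> carrier (dual_bimodule Z)"
  shows "\<phi> \<ominus>\<^bsub>dual_bimodule Z\<^esub> \<psi> = (\<lambda>z \<in> carrier Z. \<phi> z - \<psi> z)"
    and "\<phi> \<ominus>\<^bsub>dual_bimodule Z\<^esub> \<psi> \<in> carrier (dual_bimodule Z)"
proof -
  interpret abelian_group "dual_bimodule Z"
    by (rule abelian_group_dual[OF Z])
  have "\<ominus>\<^bsub>dual_bimodule Z\<^esub> \<psi> = (\<lambda>z \<in> carrier Z. - 1 * \<psi> z)"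
    by (rule minus_equality) (use assms dual_smult_closed[OF Z, of \<psi> "- 1"] in auto)
  then show "\<phi> \<ominus>\<^bsub>dual_bimodule Z\<^esub> \<psi> = (\<lambda>z \<in> carrier Z. \<phi> z - \<psi> z)"
    by (auto simp: a_minus_def intro!: restrict_ext)
  show "\<phi> \<ominus>\<^bsub>dual_bimodule Z\<^esub> \<psi> \<in> carrier (dual_bimodule Z)"
    using assms by simp
qed

lemma dual_norm_upper:
  assumes Z: "normed_space Z" and \<phi>: "\<phi> \<in> carrier (dual_bimodule Z)"
    and z: "z \<in> carrier Z" "nrm Z z \<le> 1"
  shows "cmod (\<phi> z) \<le> nrm (dual_bimodule Z) \<phi>"
  unfolding dual_bimodule_simps
proof (rule cSUP_upper)
  obtain C where C: "\<And>z. z \<in> carrier Z \<Longrightarrow> cmod (\<phi> z) \<le> C * nrm Z z"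
    using \<phi> unfolding dual_carrier_iff by blast
  show "bdd_above ((\<lambda>z. cmod (\<phi> z)) ` {z \<in> carrier Z. nrm Z z \<le> 1})"
  proof (rule bdd_aboveI2[where M = "\<bar>C\<bar>"], clarify)
    fix w assume w: "w \<in> carrier Z" "nrm Z w \<le> 1"
    have "C * nrm Z w \<le> \<bar>C\<bar> * 1"
      using w Z by (intro mult_mono) (auto simp: normed_space_def)
    with C[OF w(1)] show "cmod (\<phi> w) \<le> \<bar>C\<bar>"
      by simp
  qed
qed (use z in simp)

lemma normed_space_zero:
  assumes "normed_space Z"
  shows "\<zero>\<^bsub>Z\<^esub> \<in> carrier Z" and "nrm Z \<zero>\<^bsub>Z\<^esub> = 0"
proof -
  interpret Module.module complex_ring Z
    using assms by (simp add: normed_space_def)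
  show "\<zero>\<^bsub>Z\<^esub> \<in> carrier Z"
    by simp
  then show "nrm Z \<zero>\<^bsub>Z\<^esub> = 0"
    using assms by (simp add: normed_space_def)
qed

lemma dual_norm_nonneg:
  assumes "normed_space Z" and "\<phi> \<in> carrier (dual_bimodule Z)"
  shows "0 \<le> nrm (dual_bimodule Z) \<phi>"
  using dual_norm_upper[OF assms normed_space_zero(1)] normed_space_zero(2) assms(1)
  by (metis norm_ge_zero order_trans zero_le_one)

text \<open>Rescale \<open>z\<close> to norm 1 and use the supremum; if \<open>nrm Z z = 0\<close>,
  any bound for \<phi> already forces \<open>\<phi> z = 0\<close>.\<close>

lemma dual_norm_bound:
  assumes Z: "normed_space Z" and \<phi>: "\<phi> \<in> carrier (dual_bimodule Z)" and z: "z \<in> carrier Z"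
  shows "cmod (\<phi> z) \<le> nrm (dual_bimodule Z) \<phi> * nrm Z z"
proof (cases "nrm Z z = 0")
  case True
  then show ?thesis
    using \<phi> z unfolding dual_carrier_iff by fastforce
next
  case False
  define c where "c = complex_of_real (inverse (nrm Z z))"
  have pos: "0 < nrm Z z"
    using False Z z by (auto simp: normed_space_def less_le)
  have cz: "c \<odot>\<^bsub>Z\<^esub> z \<in> carrier Z"
    using normed_space_closed[OF Z] z by simp
  have "nrm Z (c \<odot>\<^bsub>Z\<^esub> z) = cmod c * nrm Z z"
    using Z z unfolding normed_space_def by blast
  moreover have c: "cmod c = inverse (nrm Z z)"
    using pos by (simp add: c_def norm_inverse)
  ultimately have "nrm Z (c \<odot>\<^bsub>Z\<^esub> z) \<le> 1"
    using pos by simp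
  then have "cmod (\<phi> (c \<odot>\<^bsub>Z\<^esub> z)) \<le> nrm (dual_bimodule Z) \<phi>"
    by (rule dual_norm_upper[OF Z \<phi> cz])
  moreover have "\<phi> (c \<odot>\<^bsub>Z\<^esub> z) = c * \<phi> z"
    using \<phi> z by (simp add: dual_carrier_iff)
  ultimately show ?thesis
    using pos by (simp add: c norm_mult field_simps del: dual_bimodule_simps)
qed

lemma dual_norm_le:
  assumes "normed_space Z" and "0 \<le> C" and "\<And>z. z \<in> carrier Z \<Longrightarrow> cmod (\<phi> z) \<le> C * nrm Z z"
  shows "nrm (dual_bimodule Z) \<phi> \<le> C"
  unfolding dual_bimodule_simps
proof (rule cSUP_least)
  have "\<zero>\<^bsub>Z\<^esub> \<in> carrier Z" "nrm Z \<zero>\<^bsub>Z\<^esub> = 0"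
    using normed_space_zero[OF assms(1)] by auto
  then show "{z \<in> carrier Z. nrm Z z \<le> 1} \<noteq> {}"
    by force
  fix z assume z: "z \<in> {z \<in> carrier Z. nrm Z z \<le> 1}"
  then have "C * nrm Z z \<le> C * 1"
    using assms(2) by (intro mult_left_mono) auto
  with assms(3)[of z] z show "cmod (\<phi> z) \<le> C"
    by simp
qed

lemma dual_actions_closed:
  assumes Z: "banach_bimodule A Z" and \<phi>: "\<phi> \<in> carrier (dual_bimodule Z)" and a: "a \<in> carrier A"
  shows "(\<lambda>z \<in> carrier Z. \<phi> (ract Z z a)) \<in> carrier (dual_bimodule Z)"
    and "(\<lambda>z \<in> carrier Z. \<phi> (lact Z a z)) \<in> carrier (dual_bimodule Z)"
proof -
  have nZ: "normed_space Z"
    using Z by (simp add: banach_bimodule_def banach_space_def)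
  have closed: "lact Z a z \<in> carrier Z" "ract Z z a \<in> carrier Z" if "z \<in> carrier Z" for z
    using Z a that unfolding banach_bimodule_def by blast+
  have addZ: "lact Z a (z \<oplus>\<^bsub>Z\<^esub> w) = lact Z a z \<oplus>\<^bsub>Z\<^esub> lact Z a w"
      "ract Z (z \<oplus>\<^bsub>Z\<^esub> w) a = ract Z z a \<oplus>\<^bsub>Z\<^esub> ract Z w a"
    if "z \<in> carrier Z" "w \<in> carrier Z" for z w
    using Z a that unfolding banach_bimodule_def by blast+
  have smultZ: "lact Z a (c \<odot>\<^bsub>Z\<^esub> z) = c \<odot>\<^bsub>Z\<^esub> lact Z a z" "ract Z (c \<odot>\<^bsub>Z\<^esub> z) a = c \<odot>\<^bsub>Z\<^esub> ract Z z a"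
    if "z \<in> carrier Z" for c z
    using Z a that unfolding banach_bimodule_def by blast+
  obtain C where C: "\<And>z. z \<in> carrier Z \<Longrightarrow> nrm Z (lact Z a z) \<le> C * nrm A a * nrm Z z"
    "\<And>z. z \<in> carrier Z \<Longrightarrow> nrm Z (ract Z z a) \<le> C * nrm A a * nrm Z z"
    using Z a unfolding banach_bimodule_def by blast
  let ?n = "nrm (dual_bimodule Z) \<phi>"
  note n = dual_norm_nonneg[OF nZ \<phi>]
  have "cmod (\<phi> (ract Z z a)) \<le> (?n * (C * nrm A a)) * nrm Z z" if "z \<in> carrier Z" for z
    using dual_norm_bound[OF nZ \<phi> closed(2)[OF that]] mult_left_mono[OF C(2)[OF that] n]
    by (simp add: mult.assoc)
  then have "\<exists>K. \<forall>z\<in>carrier Z. cmod (\<phi> (ract Z z a)) \<le> K * nrm Z z"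
    by blast
  then show "(\<lambda>z \<in> carrier Z. \<phi> (ract Z z a)) \<in> carrier (dual_bimodule Z)"
    using \<phi> nZ by (simp add: dual_carrier_iff normed_space_closed closed addZ smultZ)
  have "cmod (\<phi> (lact Z a z)) \<le> (?n * (C * nrm A a)) * nrm Z z" if "z \<in> carrier Z" for z
    using dual_norm_bound[OF nZ \<phi> closed(1)[OF that]] mult_left_mono[OF C(1)[OF that] n]
    by (simp add: mult.assoc)
  then have "\<exists>K. \<forall>z\<in>carrier Z. cmod (\<phi> (lact Z a z)) \<le> K * nrm Z z"
    by blast
  then show "(\<lambda>z \<in> carrier Z. \<phi> (lact Z a z)) \<in> carrier (dual_bimodule Z)"
    using \<phi> nZ by (simp add: dual_carrier_iff normed_space_closed closed addZ smultZ)
qed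

text \<open>The later argument works with finitely many algebra elements and one tolerance. Each of
  these finitely many conditions holds eventually, and a proper filter has a point where all hold at
  once, so the net is replaced by a single functional.\<close>

lemma approximately_innerD:
  assumes Z: "banach_bimodule A Z" and D: "continuous_derivation A (dual_bimodule Z) D"
    and inner: "approximately_inner A (dual_bimodule Z) D"
    and S: "finite S" "S \<subseteq> carrier A" and \<epsilon>: "0 < \<epsilon>"
  obtains \<phi> where "\<phi> \<in> carrier (dual_bimodule Z)"
    and "\<And>a z. \<lbrakk>a \<in> S; z \<in> carrier Z\<rbrakk> \<Longrightarrow>
           cmod (D a z - (\<phi> (ract Z z a) - \<phi> (lact Z a z))) \<le> \<epsilon> * nrm Z z"
proof -
  let ?Y = "dual_bimodule Z"
  have nZ: "normed_space Z"
    using Z by (simp add: banach_bimodule_def banach_space_def)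
  obtain F where F: "F \<noteq> bot" "\<forall>\<^sub>F y in F. y \<in> carrier ?Y"
    and lim: "\<And>a. a \<in> carrier A \<Longrightarrow>
      ((\<lambda>y. nrm ?Y (D a \<ominus>\<^bsub>?Y\<^esub> (lact ?Y a y \<ominus>\<^bsub>?Y\<^esub> ract ?Y y a))) \<longlongrightarrow> 0) F"
    using inner unfolding approximately_inner_def by blast
  have "\<forall>\<^sub>F y in F. nrm ?Y (D a \<ominus>\<^bsub>?Y\<^esub> (lact ?Y a y \<ominus>\<^bsub>?Y\<^esub> ract ?Y y a)) < \<epsilon>" if "a \<in> S" for a
    using order_tendstoD(2)[OF lim \<epsilon>] that S(2) by blast
  then have "\<forall>\<^sub>F y in F. \<forall>a \<in> S. nrm ?Y (D a \<ominus>\<^bsub>?Y\<^esub> (lact ?Y a y \<ominus>\<^bsub>?Y\<^esub> ract ?Y y a)) < \<epsilon>"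
    using S(1) by (simp add: eventually_ball_finite)
  from eventually_happens[OF eventually_conj[OF F(2) this]] F(1)
  obtain \<phi> where \<phi>: "\<phi> \<in> carrier ?Y"
    and small: "\<And>a. a \<in> S \<Longrightarrow> nrm ?Y (D a \<ominus>\<^bsub>?Y\<^esub> (lact ?Y a \<phi> \<ominus>\<^bsub>?Y\<^esub> ract ?Y \<phi> a)) < \<epsilon>"
    by blast
  have "cmod (D a z - (\<phi> (ract Z z a) - \<phi> (lact Z a z))) \<le> \<epsilon> * nrm Z z"
    if a: "a \<in> S" and z: "z \<in> carrier Z" for a z
  proof -
    have aA: "a \<in> carrier A"
      using a S by blast
    then have Da: "D a \<in> carrier ?Y"
      using D unfolding continuous_derivation_def bounded_linear_map_def by blast
    note acts = dual_actions_closed[OF Z \<phi> aA]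
    let ?y = "lact ?Y a \<phi> \<ominus>\<^bsub>?Y\<^esub> ract ?Y \<phi> a"
    have y: "?y \<in> carrier ?Y" "?y = (\<lambda>z \<in> carrier Z. \<phi> (ract Z z a) - \<phi> (lact Z a z))"
      using dual_minus[OF nZ acts] by (auto simp: restrict_def)
    let ?d = "D a \<ominus>\<^bsub>?Y\<^esub> ?y"
    have d: "?d \<in> carrier ?Y" "?d z = D a z - ?y z"
      using dual_minus[OF nZ Da y(1)] z by simp_all
    have "cmod (?d z) \<le> nrm ?Y ?d * nrm Z z"
      by (rule dual_norm_bound[OF nZ d(1) z])
    also have "\<dots> \<le> \<epsilon> * nrm Z z"
      using small[OF a] nZ z by (intro mult_right_mono) (auto simp: normed_space_def)
    finally show ?thesis
      using z y(2) d(2) by simp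
  qed
  with \<phi> that show thesis
    by blast
qed

section \<open>The universal derivation of an algebra of functions\<close>

lemma divide_le_if_le_mult:
  fixes x :: real
  assumes "0 \<le> p" "0 \<le> C" "x \<le> C * p"
  shows "x / p \<le> C"
  using assms by (cases "p = 0") (auto simp: divide_le_eq)

text \<open>What the duality argument asks of the Lipschitz algebra: a unit, a submultiplicative
  \<open>N\<close>, and point evaluations of norm at most 1. The metric enters only after this
  locale.\<close>

locale function_algebra =
  fixes L :: "('a \<Rightarrow> complex) set" and N :: "('a \<Rightarrow> complex) \<Rightarrow> real"
  assumes const_one: "(\<lambda>_. 1) \<in> L"
    and add: "\<lbrakk>f \<in> L; g \<in> L\<rbrakk> \<Longrightarrow> (\<lambda>x. f x + g x) \<in> L"
    and smult: "f \<in> L \<Longrightarrow> (\<lambda>x. c * f x) \<in> L"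
    and mult: "\<lbrakk>f \<in> L; g \<in> L\<rbrakk> \<Longrightarrow> (\<lambda>x. f x * g x) \<in> L"
    and N_mult: "\<lbrakk>f \<in> L; g \<in> L\<rbrakk> \<Longrightarrow> N (\<lambda>x. f x * g x) \<le> N f * N g"
    and N_point: "f \<in> L \<Longrightarrow> cmod (f x) \<le> N f"
begin

definition alg :: "('a \<Rightarrow> complex) normed_module" where
  "alg = \<lparr>carrier = L, mult = (\<lambda>f g x. f x * g x), one = (\<lambda>_. 1),
          zero = (\<lambda>_. 0), add = (\<lambda>f g x. f x + g x), smult = (\<lambda>c f x. c * f x), nrm = N\<rparr>"

lemma alg_simps [simp]:
  "carrier alg = L" "f \<otimes>\<^bsub>alg\<^esub> g = (\<lambda>x. f x * g x)" "f \<oplus>\<^bsub>alg\<^esub> g = (\<lambda>x. f x + g x)"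
  "c \<odot>\<^bsub>alg\<^esub> f = (\<lambda>x. c * f x)" "nrm alg f = N f"
  by (simp_all add: alg_def)

lemma N_nonneg: "f \<in> L \<Longrightarrow> 0 \<le> N f"
  using N_point[of f undefined] norm_ge_zero order_trans by blast

section \<open>Bounded bilinear forms as a Banach bimodule\<close>

text \<open>The value 0 outside \<open>L\<close> makes forms that agree on \<open>L\<close> equal as
  functions. The type is the one over which \<open>approximately_amenable\<close>
  quantifies.\<close>

definition forms :: "(('a \<Rightarrow> complex) \<Rightarrow> ('a \<Rightarrow> complex) \<Rightarrow> complex) set" where
  "forms = {z. (\<forall>a b. a \<notin> L \<or> b \<notin> L \<longrightarrow> z a b = 0) \<and>
     (\<forall>a \<in> L. \<forall>a' \<in> L. \<forall>b \<in> L. z (\<lambda>x. a x + a' x) b = z a b + z a' b) \<and>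
     (\<forall>a \<in> L. \<forall>b \<in> L. \<forall>b' \<in> L. z a (\<lambda>x. b x + b' x) = z a b + z a b') \<and>
     (\<forall>c. \<forall>a \<in> L. \<forall>b \<in> L. z (\<lambda>x. c * a x) b = c * z a b \<and> z a (\<lambda>x. c * b x) = c * z a b) \<and>
     (\<exists>C. \<forall>a \<in> L. \<forall>b \<in> L. cmod (z a b) \<le> C * (N a * N b))}"

text \<open>The usual norm of a bilinear form, written with quotients. A pair with
  \<open>N a * N b = 0\<close> contributes 0, since division by 0 gives 0.\<close>

definition form_norm :: "(('a \<Rightarrow> complex) \<Rightarrow> ('a \<Rightarrow> complex) \<Rightarrow> complex) \<Rightarrow> real" where
  "form_norm z = (SUP (a, b) \<in> L \<times> L. cmod (z a b) / (N a * N b))"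

text \<open>
  Subtracting \<open>z (a b) c\<close> in the left action is what makes \<open>c \<mapsto> (z \<mapsto> z 1 c)\<close> a derivation.
\<close>

definition form_module ::
    "('a \<Rightarrow> complex, ('a \<Rightarrow> complex) \<Rightarrow> ('a \<Rightarrow> complex) \<Rightarrow> complex) bimodule" where
  "form_module =
     \<lparr>carrier = forms, mult = undefined, one = undefined,
      zero = (\<lambda>_ _. 0), add = (\<lambda>z w a b. z a b + w a b), smult = (\<lambda>c z a b. c * z a b),
      nrm = form_norm,
      lact = (\<lambda>c z a b. if a \<in> L \<and> b \<in> L
        then z a (\<lambda>x. b x * c x) - z (\<lambda>x. a x * b x) c else 0),
      ract = (\<lambda>z c a b. if a \<in> L \<and> b \<in> L then z (\<lambda>x. c x * a x) b else 0)\<rparr>"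

lemma form_module_simps [simp]:
  "carrier form_module = forms" "\<zero>\<^bsub>form_module\<^esub> = (\<lambda>_ _. 0)"
  "z \<oplus>\<^bsub>form_module\<^esub> w = (\<lambda>a b. z a b + w a b)" "t \<odot>\<^bsub>form_module\<^esub> z = (\<lambda>a b. t * z a b)"
  "nrm form_module z = form_norm z"
  "lact form_module c z = (\<lambda>a b. if a \<in> L \<and> b \<in> L
     then z a (\<lambda>x. b x * c x) - z (\<lambda>x. a x * b x) c else 0)"
  "ract form_module z c = (\<lambda>a b. if a \<in> L \<and> b \<in> L then z (\<lambda>x. c x * a x) b else 0)"
  by (simp_all add: form_module_def)

lemma formsI:
  assumes "\<And>a b. a \<notin> L \<or> b \<notin> L \<Longrightarrow> z a b = 0"
    and "\<And>a a' b. \<lbrakk>a \<in> L; a' \<in> L; b \<in> L\<rbrakk> \<Longrightarrow> z (\<lambda>x. a x + a' x) b = z a b + z a' b"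
    and "\<And>a b b'. \<lbrakk>a \<in> L; b \<in> L; b' \<in> L\<rbrakk> \<Longrightarrow> z a (\<lambda>x. b x + b' x) = z a b + z a b'"
    and "\<And>c a b. \<lbrakk>a \<in> L; b \<in> L\<rbrakk> \<Longrightarrow> z (\<lambda>x. c * a x) b = c * z a b"
    and "\<And>c a b. \<lbrakk>a \<in> L; b \<in> L\<rbrakk> \<Longrightarrow> z a (\<lambda>x. c * b x) = c * z a b"
    and "\<And>a b. \<lbrakk>a \<in> L; b \<in> L\<rbrakk> \<Longrightarrow> cmod (z a b) \<le> C * (N a * N b)"
  shows "z \<in> forms"
  unfolding forms_def mem_Collect_eq using assms
  by (intro conjI allI ballI impI exI[of _ C]) auto

lemma
  assumes "z \<in> forms"
  shows forms_outside: "a \<notin> L \<or> b \<notin> L \<Longrightarrow> z a b = 0"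
    and forms_add1: "\<lbrakk>a \<in> L; a' \<in> L; b \<in> L\<rbrakk> \<Longrightarrow> z (\<lambda>x. a x + a' x) b = z a b + z a' b"
    and forms_add2: "\<lbrakk>a \<in> L; b \<in> L; b' \<in> L\<rbrakk> \<Longrightarrow> z a (\<lambda>x. b x + b' x) = z a b + z a b'"
    and forms_smult1: "\<lbrakk>a \<in> L; b \<in> L\<rbrakk> \<Longrightarrow> z (\<lambda>x. c * a x) b = c * z a b"
    and forms_smult2: "\<lbrakk>a \<in> L; b \<in> L\<rbrakk> \<Longrightarrow> z a (\<lambda>x. c * b x) = c * z a b"
  using assms by (auto simp: forms_def)

lemma form_norm_le:
  assumes "0 \<le> C" and "\<And>a b. \<lbrakk>a \<in> L; b \<in> L\<rbrakk> \<Longrightarrow> cmod (z a b) \<le> C * (N a * N b)"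
  shows "form_norm z \<le> C"
  unfolding form_norm_def
proof (rule cSUP_least)
  show "L \<times> L \<noteq> {}"
    using const_one by auto
  fix p assume p: "p \<in> L \<times> L"
  then obtain a b where ab: "p = (a, b)" "a \<in> L" "b \<in> L"
    by auto
  show "(case p of (a, b) \<Rightarrow> cmod (z a b) / (N a * N b)) \<le> C"
    using assms ab N_nonneg by (simp add: divide_le_if_le_mult)
qed

lemma form_norm_bound:
  assumes "z \<in> forms" "a \<in> L" "b \<in> L"
  shows "cmod (z a b) \<le> form_norm z * (N a * N b)"
proof -
  obtain C where C: "\<And>a b. \<lbrakk>a \<in> L; b \<in> L\<rbrakk> \<Longrightarrow> cmod (z a b) \<le> C * (N a * N b)"
    using assms(1) unfolding forms_def by blast
  show ?thesis
  proof (cases "N a * N b = 0")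
    \<comment> \<open>The quotient says nothing here, but any bound \<open>C\<close> forces
      \<open>z a b = 0\<close>.\<close>
    case True
    with C[OF assms(2,3)] show ?thesis by (metis mult_zero_right)
  next
    case False
    have nn: "0 \<le> N f * N g" if "f \<in> L" "g \<in> L" for f g
      using N_nonneg that by simp
    have pos: "0 < N a * N b"
      using False nn[OF assms(2,3)] by (metis order_le_imp_less_or_eq)
    have "cmod (z a b) / (N a * N b) \<le> form_norm z"
      unfolding form_norm_def
    proof (rule cSUP_upper2[where x = "(a, b)"])
      show "bdd_above ((\<lambda>(a, b). cmod (z a b) / (N a * N b)) ` (L \<times> L))"
      proof (rule bdd_aboveI2[where M = "\<bar>C\<bar>"], clarify)
        fix f g assume fg: "f \<in> L" "g \<in> L"
        have "cmod (z f g) \<le> \<bar>C\<bar> * (N f * N g)"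
          using C[OF fg] mult_right_mono[OF abs_ge_self nn[OF fg]] order_trans by blast
        with nn[OF fg] show "cmod (z f g) / (N f * N g) \<le> \<bar>C\<bar>"
          by (intro divide_le_if_le_mult) auto
      qed
    qed (use assms in auto)
    with pos show ?thesis
      by (simp add: pos_divide_le_eq)
  qed
qed

text \<open>Read off from the bound at the pair (1, 1), where the factor is positive because
  \<open>N\<close> of the constant 1 is at least 1.\<close>

lemma form_norm_nonneg:
  assumes "z \<in> forms"
  shows "0 \<le> form_norm z"
proof -
  have "0 < N (\<lambda>_. 1)"
    using N_point[OF const_one] by (simp add: less_le_trans[OF zero_less_one])
  moreover have "0 \<le> form_norm z * (N (\<lambda>_. 1) * N (\<lambda>_. 1))"
    using form_norm_bound[OF assms const_one const_one] norm_ge_zero order_trans by blast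
  ultimately show ?thesis
    by (metis mult_pos_pos not_le mult_less_0_iff)
qed

lemma forms_zero: "(\<lambda>_ _. 0) \<in> forms"
  by (rule formsI[where C = 0]) auto

lemma forms_add:
  assumes "z \<in> forms" "w \<in> forms"
  shows "(\<lambda>a b. z a b + w a b) \<in> forms"
proof (rule formsI[where C = "form_norm z + form_norm w"])
  fix a b assume "a \<in> L" "b \<in> L"
  then show "cmod (z a b + w a b) \<le> (form_norm z + form_norm w) * (N a * N b)"
    using form_norm_bound[of _ a b] assms norm_triangle_ineq[of "z a b" "w a b"]
    by (smt (verit, best) distrib_right)
qed (auto simp: forms_outside forms_add1 forms_add2 forms_smult1 forms_smult2 assms algebra_simps)

lemma forms_smult:
  assumes "z \<in> forms"
  shows "(\<lambda>a b. c * z a b) \<in> forms"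
proof (rule formsI[where C = "cmod c * form_norm z"])
  fix a b assume "a \<in> L" "b \<in> L"
  then show "cmod (c * z a b) \<le> (cmod c * form_norm z) * (N a * N b)"
    using form_norm_bound[OF assms] by (simp add: norm_mult mult.assoc mult_left_mono)
qed (auto simp: forms_outside forms_add1 forms_add2 forms_smult1 forms_smult2 assms algebra_simps)

lemma abelian_group_form_module: "abelian_group form_module"
proof (rule abelian_groupI, goal_cases)
  case (6 z)
  then show ?case
    using forms_smult[of z "- 1"] by (intro bexI[of _ "\<lambda>a b. - z a b"]) auto
qed (simp_all add: forms_zero forms_add ac_simps)

lemma form_minus:
  assumes "z \<in> forms" "w \<in> forms"
  shows "z \<ominus>\<^bsub>form_module\<^esub> w = (\<lambda>a b. z a b - w a b)"
proof -
  interpret abelian_group form_module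
    by (rule abelian_group_form_module)
  have "\<ominus>\<^bsub>form_module\<^esub> w = (\<lambda>a b. - w a b)"
    by (rule minus_equality) (use assms forms_smult[of w "- 1"] in auto)
  then show ?thesis
    by (simp add: a_minus_def)
qed

lemma normed_space_form_module: "normed_space form_module"
  unfolding normed_space_def
proof (intro conjI ballI allI)
  show "Module.module complex_ring form_module"
    by (rule moduleI)
       (simp_all add: cring_complex_ring abelian_group_form_module forms_smult distrib_left distrib_right mult.assoc)
next
  fix z assume "z \<in> carrier form_module"
  then show "0 \<le> nrm form_module z"
    by (simp add: form_norm_nonneg)
next
  fix z assume "z \<in> carrier form_module"
  then have z: "z \<in> forms" by simp
  have "z a b = 0" if "form_norm z = 0" for a b
    using form_norm_bound[OF z, of a b] forms_outside[OF z, of a b] that by (cases "a \<in> L \<and> b \<in> L") auto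
  moreover have "form_norm (\<lambda>_ _. 0) = 0"
    using form_norm_le[of 0 "\<lambda>_ _. 0"] form_norm_nonneg[OF forms_zero] by simp
  ultimately show "nrm form_module z = 0 \<longleftrightarrow> z = \<zero>\<^bsub>form_module\<^esub>"
    by auto
next
  fix c z assume "z \<in> carrier form_module"
  then have z: "z \<in> forms" by simp
  have le: "form_norm (\<lambda>a b. c * z a b) \<le> cmod c * form_norm z" if z: "z \<in> forms" for c z
    using form_norm_bound[OF z] form_norm_nonneg[OF z]
    by (intro form_norm_le) (auto simp: norm_mult mult.assoc mult_left_mono)
  \<comment> \<open>The reverse inequality is the forward one for the scalar
    \<open>inverse c\<close> and the form \<open>c * z\<close>.\<close>
  have "cmod c * form_norm z \<le> form_norm (\<lambda>a b. c * z a b)"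
  proof (cases "c = 0")
    case True
    then show ?thesis
      using form_norm_nonneg[OF forms_zero] by simp
  next
    case False
    then show ?thesis
      using le[OF forms_smult[OF z, of c], of "inverse c"]
      by (simp add: norm_divide field_simps)
  qed
  with le[OF z] show "nrm form_module (c \<odot>\<^bsub>form_module\<^esub> z) = cmod c * nrm form_module z"
    by (simp add: antisym)
next
  fix z w assume "z \<in> carrier form_module" "w \<in> carrier form_module"
  then have zw: "z \<in> forms" "w \<in> forms" by simp_all
  have "cmod (z a b + w a b) \<le> (form_norm z + form_norm w) * (N a * N b)" if "a \<in> L" "b \<in> L" for a b
    using form_norm_bound[of _ a b] zw that norm_triangle_ineq[of "z a b" "w a b"]
    by (smt (verit, best) distrib_right)
  then show "nrm form_module (z \<oplus>\<^bsub>form_module\<^esub> w) \<le> nrm form_module z + nrm form_module w"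
    using form_norm_nonneg zw by (simp add: form_norm_le)
qed

text \<open>The Cauchy estimate is uniform in \<open>a\<close> and \<open>b\<close> up to the factor
  \<open>N a * N b\<close>. It survives letting one index tend to infinity, so the pointwise limit
  is a bounded form and is approached in norm.\<close>

lemma banach_space_form_module: "banach_space form_module"
  unfolding banach_space_def
proof (intro conjI allI impI, goal_cases)
  case 1
  then show ?case by (rule normed_space_form_module)
next
  case (2 s)
  then have sf: "s n \<in> forms" for n
    by auto
  have diff: "(\<lambda>a b. z a b - w a b) \<in> forms" if "z \<in> forms" "w \<in> forms" for z w
    using forms_add[OF that(1) forms_smult[OF that(2), of "-1"]] by simp
  have cau: "\<exists>M. \<forall>m\<ge>M. \<forall>n\<ge>M. form_norm (\<lambda>a b. s m a b - s n a b) < e" if "e > 0" for e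
    using 2 that by (simp add: form_minus sf)
  have bnd: "\<exists>M. \<forall>m\<ge>M. \<forall>n\<ge>M. \<forall>a\<in>L. \<forall>b\<in>L. cmod (s m a b - s n a b) \<le> e * (N a * N b)" if "e > 0" for e
  proof -
    obtain M where M: "\<And>m n. m \<ge> M \<Longrightarrow> n \<ge> M \<Longrightarrow> form_norm (\<lambda>a b. s m a b - s n a b) < e"
      using cau \<open>e > 0\<close> by blast
    have "cmod (s m a b - s n a b) \<le> e * (N a * N b)" if "m \<ge> M" "n \<ge> M" "a \<in> L" "b \<in> L" for m n a b
      using form_norm_bound[OF diff[OF sf sf] that(3,4), of m n] M[OF that(1,2)] N_nonneg that(3,4)
      by (smt (verit) mult_right_mono mult_nonneg_nonneg)
    then show ?thesis by blast
  qed
  have conv: "convergent (\<lambda>n. s n a b)" for a b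
  proof (cases "a \<in> L \<and> b \<in> L")
    case True
    have "Cauchy (\<lambda>n. s n a b)"
    proof (rule CauchyI)
      fix e :: real assume e: "e > 0"
      \<comment> \<open>The summand 1 keeps the divisor positive even when
        \<open>N a * N b = 0\<close>.\<close>
      define k where "k = N a * N b + 1"
      have k: "k > 0"
        using True N_nonneg by (simp add: k_def add_nonneg_pos)
      then obtain M where M: "\<And>m n. m \<ge> M \<Longrightarrow> n \<ge> M \<Longrightarrow> cmod (s m a b - s n a b) \<le> e / k * (N a * N b)"
        using bnd[OF divide_pos_pos[OF e]] True by blast
      have "e / k * (N a * N b) < e"
        using e k by (simp add: k_def field_simps)
      with M show "\<exists>M. \<forall>m\<ge>M. \<forall>n\<ge>M. cmod (s m a b - s n a b) < e"
        by (meson le_less_trans)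
    qed
    then show ?thesis
      by (simp add: Cauchy_convergent_iff)
  next
    case False
    then have "s n a b = 0" for n
      using forms_outside[OF sf] by blast
    then show ?thesis
      by (simp add: convergent_const)
  qed
  define l where "l a b = lim (\<lambda>n. s n a b)" for a b
  have l: "(\<lambda>n. s n a b) \<longlonglongrightarrow> l a b" for a b
    using conv convergent_LIMSEQ_iff l_def by auto
  have close: "\<exists>M. \<forall>n\<ge>M. \<forall>a\<in>L. \<forall>b\<in>L. cmod (s n a b - l a b) \<le> e * (N a * N b)" if "e > 0" for e
  proof -
    obtain M where M: "\<And>m n a b. m \<ge> M \<Longrightarrow> n \<ge> M \<Longrightarrow> a \<in> L \<Longrightarrow> b \<in> L \<Longrightarrow>
        cmod (s m a b - s n a b) \<le> e * (N a * N b)"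
      using bnd \<open>e > 0\<close> by blast
    have "cmod (s n a b - l a b) \<le> e * (N a * N b)" if "n \<ge> M" "a \<in> L" "b \<in> L" for n a b
    proof (rule LIMSEQ_le_const2)
      show "(\<lambda>m. cmod (s n a b - s m a b)) \<longlonglongrightarrow> cmod (s n a b - l a b)"
        by (intro tendsto_intros l)
      show "\<exists>K. \<forall>m\<ge>K. cmod (s n a b - s m a b) \<le> e * (N a * N b)"
        using M that by blast
    qed
    then show ?thesis by blast
  qed
  obtain M where M: "\<And>a b. a \<in> L \<Longrightarrow> b \<in> L \<Longrightarrow> cmod (s M a b - l a b) \<le> 1 * (N a * N b)"
    using close[of 1] by auto
  have lf: "l \<in> forms"
  proof (rule formsI[where C = "form_norm (s M) + 1"])
    fix a b assume "a \<notin> L \<or> b \<notin> L"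
    then show "l a b = 0"
      using l[of a b] forms_outside[OF sf] by (simp add: LIMSEQ_const_iff)
  next
    fix a a' b assume h: "a \<in> L" "a' \<in> L" "b \<in> L"
    have "(\<lambda>n. s n (\<lambda>x. a x + a' x) b) \<longlonglongrightarrow> l a b + l a' b"
      using tendsto_add[OF l[of a b] l[of a' b]] h by (simp add: forms_add1[OF sf])
    with l show "l (\<lambda>x. a x + a' x) b = l a b + l a' b"
      using LIMSEQ_unique by blast
  next
    fix a b b' assume h: "a \<in> L" "b \<in> L" "b' \<in> L"
    have "(\<lambda>n. s n a (\<lambda>x. b x + b' x)) \<longlonglongrightarrow> l a b + l a b'"
      using tendsto_add[OF l[of a b] l[of a b']] h by (simp add: forms_add2[OF sf])
    with l show "l a (\<lambda>x. b x + b' x) = l a b + l a b'"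
      using LIMSEQ_unique by blast
  next
    fix c a b assume h: "a \<in> L" "b \<in> L"
    have "(\<lambda>n. s n (\<lambda>x. c * a x) b) \<longlonglongrightarrow> c * l a b"
      using tendsto_mult_left[OF l[of a b], of c] h by (simp add: forms_smult1[OF sf])
    with l show "l (\<lambda>x. c * a x) b = c * l a b"
      using LIMSEQ_unique by blast
    have "(\<lambda>n. s n a (\<lambda>x. c * b x)) \<longlonglongrightarrow> c * l a b"
      using tendsto_mult_left[OF l[of a b], of c] h by (simp add: forms_smult2[OF sf])
    with l show "l a (\<lambda>x. c * b x) = c * l a b"
      using LIMSEQ_unique by blast
  next
    fix a b assume h: "a \<in> L" "b \<in> L"
    have "cmod (l a b) \<le> cmod (s M a b) + cmod (s M a b - l a b)"
      by (metis norm_minus_commute norm_triangle_sub)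
    then show "cmod (l a b) \<le> (form_norm (s M) + 1) * (N a * N b)"
      using form_norm_bound[OF sf h, of M] M[OF h] by (simp add: algebra_simps)
  qed
  have "(\<lambda>n. form_norm (\<lambda>a b. s n a b - l a b)) \<longlonglongrightarrow> 0"
  proof (rule LIMSEQ_I)
    fix e :: real assume "e > 0"
    then obtain M where M: "\<And>n a b. n \<ge> M \<Longrightarrow> a \<in> L \<Longrightarrow> b \<in> L \<Longrightarrow> cmod (s n a b - l a b) \<le> e / 2 * (N a * N b)"
      using close[of "e / 2"] by auto
    have "norm (form_norm (\<lambda>a b. s n a b - l a b) - 0) < e" if "n \<ge> M" for n
      using form_norm_le[of "e / 2" "\<lambda>a b. s n a b - l a b"] M[OF that] \<open>e > 0\<close>
        form_norm_nonneg[OF diff[OF sf lf], of n] by auto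
    then show "\<exists>M. \<forall>n\<ge>M. norm (form_norm (\<lambda>a b. s n a b - l a b) - 0) < e"
      by blast
  qed
  then have "(\<lambda>n. nrm form_module (s n \<ominus>\<^bsub>form_module\<^esub> l)) \<longlonglongrightarrow> 0"
    by (simp add: form_minus sf lf)
  with lf show ?case
    by (intro bexI[of _ l]) simp_all
qed

text \<open>The left action has two terms, each at most
  \<open>N c * form_norm z * (N a * N b)\<close>. The resulting factor 2 is kept for the right
  action, so that one constant serves both.\<close>

lemma form_actions_closed:
  assumes "z \<in> forms" "c \<in> L"
  shows "lact form_module c z \<in> forms" "ract form_module z c \<in> forms"
    and "form_norm (lact form_module c z) \<le> 2 * N c * form_norm z"
    and "form_norm (ract form_module z c) \<le> 2 * N c * form_norm z"
proof -
  let ?n = "form_norm z"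
  note n = form_norm_nonneg[OF assms(1)]
  have l: "cmod (z a (\<lambda>x. b x * c x) - z (\<lambda>x. a x * b x) c) \<le> 2 * N c * ?n * (N a * N b)"
    if "a \<in> L" "b \<in> L" for a b
  proof -
    have "?n * (N a * N (\<lambda>x. b x * c x)) \<le> ?n * (N a * (N b * N c))"
      "?n * (N (\<lambda>x. a x * b x) * N c) \<le> ?n * ((N a * N b) * N c)"
      using N_nonneg N_mult that assms n by (simp_all add: mult_left_mono mult_right_mono)
    with form_norm_bound[OF assms(1), of a "\<lambda>x. b x * c x"] form_norm_bound[OF assms(1), of "\<lambda>x. a x * b x" c]
      norm_triangle_ineq4[of "z a (\<lambda>x. b x * c x)" "z (\<lambda>x. a x * b x) c"] that assms mult
    show ?thesis
      by (simp add: mult.assoc mult.left_commute mult.commute)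
  qed
  have r: "cmod (z (\<lambda>x. c x * a x) b) \<le> 2 * N c * ?n * (N a * N b)" if "a \<in> L" "b \<in> L" for a b
  proof -
    have "?n * (N (\<lambda>x. c x * a x) * N b) \<le> ?n * ((N c * N a) * N b)"
      using N_nonneg N_mult that assms n by (simp add: mult_left_mono mult_right_mono)
    moreover have "0 \<le> ?n * ((N c * N a) * N b)"
      using N_nonneg that assms n by simp
    ultimately show ?thesis
      using form_norm_bound[OF assms(1), of "\<lambda>x. c x * a x" b] that assms mult
      by (simp add: mult.assoc mult.left_commute mult.commute)
  qed
  have C: "0 \<le> 2 * N c * ?n"
    using N_nonneg n assms by simp
  show "form_norm (lact form_module c z) \<le> 2 * N c * form_norm z"
    using l by (intro form_norm_le[OF C]) auto
  show "form_norm (ract form_module z c) \<le> 2 * N c * form_norm z"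
    using r by (intro form_norm_le[OF C]) auto
  note lin = forms_add1[OF assms(1)] forms_add2[OF assms(1)] forms_smult1[OF assms(1)]
    forms_smult2[OF assms(1)]
  show "lact form_module c z \<in> forms"
  proof (rule formsI[where C = "2 * N c * ?n"], goal_cases)
    case (2 a a' b)
    then show ?case
      using lin(1)[of "\<lambda>x. a x * b x" "\<lambda>x. a' x * b x" c] assms
      by (simp add: add mult lin distrib_right)
  next
    case (3 a b b')
    then show ?case
      using lin(1)[of "\<lambda>x. a x * b x" "\<lambda>x. a x * b' x" c] lin(2)[of a "\<lambda>x. b x * c x" "\<lambda>x. b' x * c x"] assms
      by (simp add: add mult distrib_right distrib_left)
  next
    case (4 t a b)
    then show ?case
      using lin(3)[of "\<lambda>x. a x * b x" c t] assms
      by (simp add: smult mult lin right_diff_distrib mult.assoc)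
  next
    case (5 t a b)
    then show ?case
      using lin(3)[of "\<lambda>x. a x * b x" c t] lin(4)[of a "\<lambda>x. b x * c x" t] assms
      by (simp add: smult mult right_diff_distrib mult.assoc mult.left_commute)
  qed (use l in auto)
  show "ract form_module z c \<in> forms"
  proof (rule formsI[where C = "2 * N c * ?n"], goal_cases)
    case (2 a a' b)
    then show ?case
      using lin(1)[of "\<lambda>x. c x * a x" "\<lambda>x. c x * a' x" b] assms
      by (simp add: add mult distrib_left)
  next
    case (4 t a b)
    then show ?case
      using lin(3)[of "\<lambda>x. c x * a x" b t] assms
      by (simp add: smult mult mult.left_commute)
  qed (use r assms in \<open>auto simp: lin add mult smult\<close>)
qed

text \<open>The left action is associative because the correction terms cancel: at \<open>f\<close>,
  \<open>g\<close> the iterated action of \<open>a\<close> after \<open>b\<close> is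
  \<open>z f (g a b) - z (f g a) b - z (f g) (a b) + z (f g a) b\<close>.\<close>

lemma banach_bimodule_form_module: "banach_bimodule alg form_module"
  unfolding banach_bimodule_def
proof (intro conjI ballI allI, goal_cases)
  case 1
  show ?case by (rule banach_space_form_module)
next
  case (6 a b z)
  then have "a \<in> L" "b \<in> L" "z \<in> forms" by simp_all
  note lin = forms_add1[OF this(3)] forms_add2[OF this(3)]
  show ?case
  proof (intro ext)
    fix f g
    show "lact form_module (a \<oplus>\<^bsub>alg\<^esub> b) z f g =
      (lact form_module a z \<oplus>\<^bsub>form_module\<^esub> lact form_module b z) f g"
      using \<open>a \<in> L\<close> \<open>b \<in> L\<close> lin(2)[of f "\<lambda>x. g x * a x" "\<lambda>x. g x * b x"]
      by (simp add: lin mult distrib_left)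
  qed
next
  case (7 a b z)
  then have "a \<in> L" "b \<in> L" "z \<in> forms" by simp_all
  note lin = forms_add1[OF this(3)] forms_add2[OF this(3)]
  show ?case
  proof (intro ext)
    fix f g
    show "ract form_module z (a \<oplus>\<^bsub>alg\<^esub> b) f g =
      (ract form_module z a \<oplus>\<^bsub>form_module\<^esub> ract form_module z b) f g"
      using \<open>a \<in> L\<close> \<open>b \<in> L\<close> lin(1)[of "\<lambda>x. a x * f x" "\<lambda>x. b x * f x" g]
      by (simp add: lin mult distrib_right)
  qed
next
  case (8 c a z)
  then have "a \<in> L" "z \<in> forms" by simp_all
  note lin = forms_smult1[OF this(2)] forms_smult2[OF this(2)]
  show ?case
  proof (intro ext)
    fix f g
    show "lact form_module (c \<odot>\<^bsub>alg\<^esub> a) z f g = (c \<odot>\<^bsub>form_module\<^esub> lact form_module a z) f g"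
      using \<open>a \<in> L\<close> lin(2)[of f "\<lambda>x. g x * a x" c]
      by (simp add: lin mult right_diff_distrib mult.left_commute)
  qed
next
  case (10 c a z)
  then have "a \<in> L" "z \<in> forms" by simp_all
  note lin = forms_smult1[OF this(2)]
  show ?case
  proof (intro ext)
    fix f g
    show "ract form_module z (c \<odot>\<^bsub>alg\<^esub> a) f g = (c \<odot>\<^bsub>form_module\<^esub> ract form_module z a) f g"
      using \<open>a \<in> L\<close> lin(1)[of "\<lambda>x. a x * f x" g c]
      by (simp add: mult mult.assoc)
  qed
next
  case 15
  then show ?case
    using form_actions_closed by (auto intro!: exI[of _ 2])
qed (use form_actions_closed in \<open>auto simp: mult mult.assoc mult.left_commute mult.commute
       right_diff_distrib intro!: ext\<close>)

section \<open>The universal derivation and its almost implementing functionals\<close>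

text \<open>Leibniz rule at \<open>z\<close>: the summand from \<open>D b\<close> is
  \<open>z a b\<close>, the one from \<open>D a\<close> is \<open>z 1 (a b) - z a b\<close>, and
  together they give \<open>z 1 (a b)\<close>.\<close>

lemma continuous_derivation_forms:
  "continuous_derivation alg (dual_bimodule form_module) (\<lambda>c. \<lambda>z \<in> forms. z (\<lambda>_. 1) c)"
  unfolding continuous_derivation_def bounded_linear_map_def
proof (intro conjI ballI allI)
  have bound: "cmod (z (\<lambda>_. 1) c) \<le> (N (\<lambda>_. 1) * N c) * form_norm z" if "z \<in> forms" "c \<in> L" for z c
    using form_norm_bound[OF that(1) const_one that(2)] by (simp add: mult.commute)
  show "(\<lambda>c. \<lambda>z \<in> forms. z (\<lambda>_. 1) c) \<in> carrier alg \<rightarrow> carrier (dual_bimodule form_module)"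
  proof
    fix c assume "c \<in> carrier alg"
    with bound have "\<exists>C. \<forall>z \<in> forms. cmod (z (\<lambda>_. 1) c) \<le> C * form_norm z"
      by (intro exI[of _ "N (\<lambda>_. 1) * N c"]) simp
    then show "(\<lambda>z \<in> forms. z (\<lambda>_. 1) c) \<in> carrier (dual_bimodule form_module)"
      by (simp add: dual_carrier_iff forms_add forms_smult)
  qed
  have "nrm (dual_bimodule form_module) (\<lambda>z \<in> forms. z (\<lambda>_. 1) c) \<le> N (\<lambda>_. 1) * N c" if "c \<in> L" for c
    using bound that N_nonneg const_one
    by (intro dual_norm_le[OF normed_space_form_module]) auto
  then show "\<exists>C. \<forall>c \<in> carrier alg.
      nrm (dual_bimodule form_module) (\<lambda>z \<in> forms. z (\<lambda>_. 1) c) \<le> C * nrm alg c"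
    by (metis alg_simps(1,5))
qed (auto simp: forms_add2 forms_smult2 const_one mult form_actions_closed(1,2)
      simp del: form_module_simps(6,7) intro!: restrict_ext, auto simp: const_one)

text \<open>
  Both actions of \<open>c\<close> multiply the point form by a number, \<open>c y\<close> on the left and \<open>c x\<close> on the right.
  If a functional \<open>\<phi>\<close> implements the derivation approximately, then \<open>1 + \<phi> (point_form x y)\<close> behaves
  like the value at \<open>(x, y)\<close> of an approximate diagonal of the algebra.
\<close>

definition point_form :: "'a \<Rightarrow> 'a \<Rightarrow> ('a \<Rightarrow> complex) \<Rightarrow> ('a \<Rightarrow> complex) \<Rightarrow> complex" where
  "point_form x y a b = (if a \<in> L \<and> b \<in> L then a x * (b y - b x) else 0)"

lemma point_form_in_forms: "point_form x y \<in> forms"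
proof (rule formsI[where C = 2])
  fix a b assume ab: "a \<in> L" "b \<in> L"
  have "cmod (b y - b x) \<le> 2 * N b"
    using norm_triangle_ineq4[of "b y" "b x"] N_point[OF ab(2), of x] N_point[OF ab(2), of y] by simp
  then have "cmod (a x * (b y - b x)) \<le> N a * (2 * N b)"
    unfolding norm_mult using N_point ab N_nonneg by (intro mult_mono) auto
  with ab show "cmod (point_form x y a b) \<le> 2 * (N a * N b)"
    by (simp add: point_form_def)
qed (auto simp: point_form_def add smult algebra_simps)

lemma point_form_actions:
  assumes "c \<in> L"
  shows "lact form_module c (point_form x y) = (\<lambda>a b. c y * point_form x y a b)"
    and "ract form_module (point_form x y) c = (\<lambda>a b. c x * point_form x y a b)"
  using assms by (auto simp: point_form_def mult algebra_simps intro!: ext)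

text \<open>The function is \<open>F x y = 1 + \<phi> (point_form x y)\<close> for an almost
  implementing \<phi>, and \<open>C\<close> is the norm of \<phi>. Thus \<open>C\<close> is fixed
  before any points are chosen, which later permits a limit along a sequence. The three estimates
  are those for \<phi> itself, for point forms, and for products of two differences of evaluations,
  whose norm is only \<open>s * t\<close>.\<close>

lemma approximate_diagonal:
  assumes "approximately_amenable alg" and S: "finite S" "S \<subseteq> L" and \<epsilon>: "0 < \<epsilon>"
  obtains F :: "'a \<Rightarrow> 'a \<Rightarrow> complex" and C where
    "\<And>x p s. \<lbrakk>0 \<le> s; \<And>h. h \<in> L \<Longrightarrow> cmod (h x - h p) \<le> s * N h\<rbrakk> \<Longrightarrow>
       cmod (F x p - 1) \<le> C * s \<and> cmod (F p x - 1) \<le> C * s"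
    "\<And>x p s c. \<lbrakk>0 \<le> s; \<And>h. h \<in> L \<Longrightarrow> cmod (h x - h p) \<le> s * N h; c \<in> S\<rbrakk> \<Longrightarrow>
       cmod ((c x - c p) * F x p) \<le> \<epsilon> * s \<and> cmod ((c p - c x) * F p x) \<le> \<epsilon> * s"
    "\<And>x y p s t c. \<lbrakk>0 \<le> s; \<And>h. h \<in> L \<Longrightarrow> cmod (h x - h p) \<le> s * N h;
       0 \<le> t; \<And>h. h \<in> L \<Longrightarrow> cmod (h y - h p) \<le> t * N h; c \<in> S\<rbrakk> \<Longrightarrow>
       cmod ((c x - c y) * F x y - (c x - c p) * F x p - (c p - c y) * F p y) \<le> \<epsilon> * (s * t)"
proof -
  let ?D = "\<lambda>c. \<lambda>z \<in> forms. z (\<lambda>_. 1) c"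
  have "approximately_inner alg (dual_bimodule form_module) ?D"
    using assms(1) banach_bimodule_form_module continuous_derivation_forms
    unfolding approximately_amenable_def by blast
  then obtain \<phi> where \<phi>: "\<phi> \<in> carrier (dual_bimodule form_module)"
    and inner: "\<And>c z. \<lbrakk>c \<in> S; z \<in> forms\<rbrakk> \<Longrightarrow>
      cmod (z (\<lambda>_. 1) c - (\<phi> (ract form_module z c) - \<phi> (lact form_module c z))) \<le> \<epsilon> * form_norm z"
    using approximately_innerD[OF banach_bimodule_form_module continuous_derivation_forms _ S(1) _ \<epsilon>] S(2)
    by (auto simp del: form_module_simps(6,7))
  let ?C = "nrm (dual_bimodule form_module) \<phi>"
  have \<phi>_bound: "cmod (\<phi> z) \<le> ?C * form_norm z" if "z \<in> forms" for z
    using dual_norm_bound[OF normed_space_form_module \<phi>, of z] that by simp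
  have \<phi>_add: "\<phi> (\<lambda>a b. z a b + w a b) = \<phi> z + \<phi> w" if "z \<in> forms" "w \<in> forms" for z w
    using \<phi> that by (simp add: dual_carrier_iff)
  have \<phi>_smult: "\<phi> (\<lambda>a b. t * z a b) = t * \<phi> z" if "z \<in> forms" for t z
    using \<phi> that by (simp add: dual_carrier_iff)
  note C = dual_norm_nonneg[OF normed_space_form_module \<phi>]
  define F where "F x y = 1 + \<phi> (point_form x y)" for x y
  note pf = point_form_in_forms
  \<comment> \<open>On a point form the derivation gives \<open>c y - c x\<close> and the inner part
    \<open>(c x - c y) * \<phi> (point_form x y)\<close>; the difference is
    \<open>- ((c x - c y) * F x y)\<close>.\<close>
  have single: "cmod ((c x - c y) * F x y) \<le> \<epsilon> * form_norm (point_form x y)" if c: "c \<in> S" for c x y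
  proof -
    have cL: "c \<in> L" using c S by blast
    have "cmod ((c x - c y) * F x y) =
      cmod (point_form x y (\<lambda>_. 1) c - (\<phi> (ract form_module (point_form x y) c) - \<phi> (lact form_module c (point_form x y))))"
      unfolding point_form_actions[OF cL] \<phi>_smult[OF pf]
      using cL const_one by (subst norm_minus_cancel[symmetric]) (simp add: point_form_def F_def algebra_simps)
    with inner[OF c pf] show ?thesis by simp
  qed
  \<comment> \<open>In either order the second argument is differenced between \<open>x\<close> and
    \<open>p\<close>, giving \<open>s * N b\<close>, and evaluating the first gives at most
    \<open>N a\<close>.\<close>
  have norms: "form_norm (point_form x p) \<le> s" "form_norm (point_form p x) \<le> s"
    if "0 \<le> s" "\<And>h. h \<in> L \<Longrightarrow> cmod (h x - h p) \<le> s * N h" for x p s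
  proof -
    have "cmod (a u * (b x - b p)) \<le> s * (N a * N b)" if "a \<in> L" "b \<in> L" for a b u
      using mult_mono[OF N_point[OF that(1)] \<open>\<And>h. h \<in> L \<Longrightarrow> cmod (h x - h p) \<le> s * N h\<close>[OF that(2)]]
        that N_nonneg by (simp add: norm_mult mult.left_commute)
    moreover have "cmod (a u * (b p - b x)) = cmod (a u * (b x - b p))" for a b :: "'a \<Rightarrow> complex" and u
      by (simp add: norm_mult norm_minus_commute)
    ultimately show "form_norm (point_form x p) \<le> s" "form_norm (point_form p x) \<le> s"
      using that(1) by (auto intro!: form_norm_le simp: point_form_def)
  qed
  show thesis
  proof (rule that[of F ?C], goal_cases)
    case (1 x p s)
    have "cmod (\<phi> (point_form x p)) \<le> ?C * s" "cmod (\<phi> (point_form p x)) \<le> ?C * s"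
      using \<phi>_bound[OF pf] mult_left_mono[OF norms(1)[OF 1] C] mult_left_mono[OF norms(2)[OF 1] C]
        order_trans by blast+
    then show ?case
      by (simp add: F_def)
  next
    case (2 x p s c)
    have "\<epsilon> * form_norm (point_form x p) \<le> \<epsilon> * s" "\<epsilon> * form_norm (point_form p x) \<le> \<epsilon> * s"
      using norms[OF 2(1,2)] \<epsilon> by simp_all
    with single[OF 2(3)] show ?case
      using order_trans by blast
  next
    case (3 x y p s t c)
    \<comment> \<open>The product of the differences of evaluations at \<open>x\<close>,
      \<open>p\<close> and at \<open>y\<close>, \<open>p\<close>. It vanishes when the first
      argument is the constant 1, so the derivation contributes nothing, and it is a combination of
      three point forms, on which the actions are known.\<close>
    define z where "z = (\<lambda>a b. if a \<in> L \<and> b \<in> L then (a x - a p) * (b y - b p) else 0)"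
    have comb: "(\<lambda>a b. k * point_form x y a b + (l * point_form x p a b + m * point_form p y a b)) \<in> forms"
      "\<phi> (\<lambda>a b. k * point_form x y a b + (l * point_form x p a b + m * point_form p y a b)) =
        k * \<phi> (point_form x y) + (l * \<phi> (point_form x p) + m * \<phi> (point_form p y))" for k l m
      by (simp_all add: \<phi>_add \<phi>_smult pf forms_add forms_smult)
    have z_eq: "z = (\<lambda>a b. 1 * point_form x y a b + ((- 1) * point_form x p a b + (- 1) * point_form p y a b))"
      by (auto simp: z_def point_form_def fun_eq_iff algebra_simps)
    have z: "z \<in> forms"
      unfolding z_eq by (rule comb(1))
    have cL: "c \<in> L"
      using 3 S by blast
    have "lact form_module c z = (\<lambda>a b. c y * point_form x y a b +
        ((- c p) * point_form x p a b + (- c y) * point_form p y a b))"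
      "ract form_module z c = (\<lambda>a b. c x * point_form x y a b +
        ((- c x) * point_form x p a b + (- c p) * point_form p y a b))"
      using cL by (auto simp: z_def point_form_def mult fun_eq_iff algebra_simps)
    then have acts: "\<phi> (lact form_module c z) = c y * \<phi> (point_form x y) +
        ((- c p) * \<phi> (point_form x p) + (- c y) * \<phi> (point_form p y))"
      "\<phi> (ract form_module z c) = c x * \<phi> (point_form x y) +
        ((- c x) * \<phi> (point_form x p) + (- c p) * \<phi> (point_form p y))"
      by (simp_all only: comb(2))
    have z1: "z (\<lambda>_. 1) c = 0"
      by (simp add: z_def)
    have "cmod ((c x - c y) * F x y - (c x - c p) * F x p - (c p - c y) * F p y) =
      cmod (z (\<lambda>_. 1) c - (\<phi> (ract form_module z c) - \<phi> (lact form_module c z)))"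
      unfolding acts z1
      by (subst norm_minus_cancel[symmetric]) (simp add: F_def algebra_simps)
    also have "\<dots> \<le> \<epsilon> * form_norm z"
      using inner[OF 3(5) z] .
    also have "form_norm z \<le> s * t"
    proof (rule form_norm_le)
      fix a b assume ab: "a \<in> L" "b \<in> L"
      show "cmod (z a b) \<le> s * t * (N a * N b)"
        using mult_mono[OF 3(2)[OF ab(1)] 3(4)[OF ab(2)]] ab 3(1) N_nonneg
        by (simp add: z_def norm_mult ac_simps)
    qed (use 3 in simp)
    finally show ?case
      using \<epsilon> by simp
  qed
qed

section \<open>The contradiction along a sequence with alternating supports\<close>

text \<open>Dividing by the values of \<open>a\<close> and \<open>b\<close> costs a factor
  \<open>4 * 2 ^ n\<close>. The decay \<open>1 / 8 ^ n\<close> of \<open>s\<close> compensates this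
  and leaves steps of order \<open>1 / 4 ^ n\<close>, which are summable.\<close>

lemma not_approximately_amenable_if_alternating:
  fixes p :: 'a and x :: "nat \<Rightarrow> 'a" and s :: "nat \<Rightarrow> real"
  assumes s: "\<And>n. 0 < s n" "\<And>n. s n \<le> 1 / 8 ^ n"
    and modulus: "\<And>h n. h \<in> L \<Longrightarrow> cmod (h (x n) - h p) \<le> s n * N h"
    and a: "a \<in> L" "a p = 0" "\<And>n. even n \<Longrightarrow> s n / (4 * 2 ^ n) \<le> cmod (a (x n))" "\<And>n. odd n \<Longrightarrow> a (x n) = 0"
    and b: "b \<in> L" "b p = 0" "\<And>n. odd n \<Longrightarrow> s n / (4 * 2 ^ n) \<le> cmod (b (x n))" "\<And>n. even n \<Longrightarrow> b (x n) = 0"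
  shows "\<not> approximately_amenable alg"
proof
  assume am: "approximately_amenable alg"
  have s0: "0 \<le> s n" for n
    using s(1)[of n] by simp
  \<comment> \<open>The chain below starts at size at most \<open>4 * \<epsilon>\<close> and moves
    by at most \<open>12 * \<epsilon>\<close> in total; this choice makes the sum 1/2.\<close>
  define \<epsilon> :: real where "\<epsilon> = 1 / 32"
  have "0 < \<epsilon>"
    by (simp add: \<epsilon>_def)
  obtain F C where
    one: "\<And>n. cmod (F (x n) p - 1) \<le> C * s n \<and> cmod (F p (x n) - 1) \<le> C * s n" and
    single: "\<And>n c. c \<in> {a, b} \<Longrightarrow> cmod ((c (x n) - c p) * F (x n) p) \<le> \<epsilon> * s n" and
    double: "\<And>i j c. c \<in> {a, b} \<Longrightarrow>
      cmod ((c (x i) - c (x j)) * F (x i) (x j) - (c (x i) - c p) * F (x i) p - (c p - c (x j)) * F p (x j))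
        \<le> \<epsilon> * (s i * s j)"
  proof (rule approximate_diagonal[OF am _ _ \<open>0 < \<epsilon>\<close>, of "{a, b}"])
    fix F C
    assume F: "\<And>x p s. \<lbrakk>0 \<le> s; \<And>h. h \<in> L \<Longrightarrow> cmod (h x - h p) \<le> s * N h\<rbrakk> \<Longrightarrow>
       cmod (F x p - 1) \<le> C * s \<and> cmod (F p x - 1) \<le> C * s"
      "\<And>x p s c. \<lbrakk>0 \<le> s; \<And>h. h \<in> L \<Longrightarrow> cmod (h x - h p) \<le> s * N h; c \<in> {a, b}\<rbrakk> \<Longrightarrow>
       cmod ((c x - c p) * F x p) \<le> \<epsilon> * s \<and> cmod ((c p - c x) * F p x) \<le> \<epsilon> * s"
      "\<And>x y p s t c. \<lbrakk>0 \<le> s; \<And>h. h \<in> L \<Longrightarrow> cmod (h x - h p) \<le> s * N h;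
       0 \<le> t; \<And>h. h \<in> L \<Longrightarrow> cmod (h y - h p) \<le> t * N h; c \<in> {a, b}\<rbrakk> \<Longrightarrow>
       cmod ((c x - c y) * F x y - (c x - c p) * F x p - (c p - c y) * F p y) \<le> \<epsilon> * (s * t)"
    show thesis
      by (rule that[OF F(1)[OF s0 modulus] conjunct1[OF F(2)[OF s0 modulus]] F(3)[OF s0 modulus s0 modulus]])
  qed (use a(1) b(1) in auto)
  \<comment> \<open>The factor \<open>s n\<close> cancels: it occurs in the lower bound for
    \<open>w\<close> and in the upper bound for the product.\<close>
  have quot: "cmod z \<le> \<epsilon> * k * (4 * 2 ^ n)"
    if "s n / (4 * 2 ^ n) \<le> cmod w" "cmod (w * z) \<le> \<epsilon> * (s n * k)" for w z :: complex and n k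
  proof -
    have "s n / (4 * 2 ^ n) * cmod z \<le> \<epsilon> * (s n * k)"
      using that mult_right_mono[OF that(1), of "cmod z"] by (simp add: norm_mult)
    then have "s n * cmod z \<le> s n * (\<epsilon> * k * (4 * 2 ^ n))"
      by (simp add: divide_le_eq ac_simps)
    then show ?thesis
      using s(1)[of n] by (simp only: mult_le_cancel_left_pos)
  qed
  define T where "T n = (if even n then F (x n) p else F p (x n))" for n
  \<comment> \<open>The bridge is \<open>F (x i) (x j)\<close>. As \<open>a\<close> vanishes at
    \<open>p\<close> and \<open>x j\<close>, the element \<open>a\<close> compares it with
    \<open>F (x i) p\<close>; as \<open>b\<close> vanishes at \<open>p\<close> and
    \<open>x i\<close>, the element \<open>b\<close> compares it with
    \<open>F p (x j)\<close>.\<close>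
  have link: "cmod (F (x i) p - F p (x j)) \<le> \<epsilon> * (s j * (4 * 2 ^ i) + s i * (4 * 2 ^ j))"
    if "even i" "odd j" for i j
  proof -
    have "cmod (F (x i) (x j) - F (x i) p) \<le> \<epsilon> * s j * (4 * 2 ^ i)"
    proof (rule quot[OF a(3)[OF that(1)]])
      show "cmod (a (x i) * (F (x i) (x j) - F (x i) p)) \<le> \<epsilon> * (s i * s j)"
        using double[of a i j] a that by (simp add: right_diff_distrib)
    qed
    moreover have "cmod (F p (x j) - F (x i) (x j)) \<le> \<epsilon> * s i * (4 * 2 ^ j)"
    proof (rule quot[OF b(3)[OF that(2)]])
      show "cmod (b (x j) * (F p (x j) - F (x i) (x j))) \<le> \<epsilon> * (s j * s i)"
        using double[of b i j] b that by (simp add: right_diff_distrib mult.commute)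
    qed
    ultimately have "cmod ((F (x i) (x j) - F (x i) p) + (F p (x j) - F (x i) (x j)))
        \<le> \<epsilon> * s j * (4 * 2 ^ i) + \<epsilon> * s i * (4 * 2 ^ j)"
      by (rule norm_triangle_mono)
    then show ?thesis
      by (simp add: norm_minus_commute algebra_simps)
  qed
  have step: "cmod (T (Suc n) - T n) \<le> \<epsilon> * (9 / 4 ^ n)" for n
  proof -
    have "cmod (T (Suc n) - T n) \<le> \<epsilon> * (s n * (4 * 2 ^ Suc n) + s (Suc n) * (4 * 2 ^ n))"
      using link[of n "Suc n"] link[of "Suc n" n]
      by (cases "even n") (simp_all add: T_def norm_minus_commute add.commute)
    also have "s n * (4 * 2 ^ Suc n) + s (Suc n) * (4 * 2 ^ n)
        \<le> 1 / 8 ^ n * (4 * 2 ^ Suc n) + 1 / 8 ^ Suc n * (4 * 2 ^ n)"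
      using s(2)[of n] s(2)[of "Suc n"] by (intro add_mono mult_right_mono) auto
    also have "\<dots> = 17 / 2 * (2 ^ n / 8 ^ n)"
      by simp
    also have "(2::real) ^ n / 8 ^ n = 1 / 4 ^ n"
      by (simp add: power_divide[symmetric] power_one_over[symmetric])
    \<comment> \<open>Rounding up to 9 makes the geometric series of the steps sum to 12.\<close>
    also have "17 / 2 * (1 / 4 ^ n) \<le> (9 / 4 ^ n :: real)"
      by (simp add: field_simps)
    finally show ?thesis
      using \<open>0 < \<epsilon>\<close> by simp
  qed
  \<comment> \<open>The term \<open>12 / 4 ^ n\<close> is the sum of the steps
    \<open>9 / 4 ^ k\<close> over \<open>k \<ge> n\<close>, that is, the variation still to
    come.\<close>
  have bound: "cmod (T n) \<le> \<epsilon> * (16 - 12 / 4 ^ n)" for n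
  proof (induction n)
    case 0
    have "cmod (T 0) \<le> \<epsilon> * 1 * (4 * 2 ^ 0)"
      unfolding T_def using single[of a 0] a(2) by (intro quot[OF a(3)]) simp_all
    then show ?case
      by simp
  next
    case (Suc n)
    have "cmod (T (Suc n)) \<le> cmod (T n) + cmod (T (Suc n) - T n)"
      by (simp add: norm_triangle_sub)
    also have "\<dots> \<le> \<epsilon> * (16 - 12 / 4 ^ n) + \<epsilon> * (9 / 4 ^ n)"
      using Suc step by (intro add_mono)
    also have "\<dots> = \<epsilon> * (16 - 12 / 4 ^ Suc n)"
      by (simp add: field_simps)
    finally show ?case .
  qed
  have "s \<longlonglongrightarrow> 0"
  proof (rule tendsto_sandwich[of "\<lambda>_. 0" _ _ "\<lambda>n. (1 / 8) ^ n"])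
    show "\<forall>\<^sub>F n in sequentially. s n \<le> (1 / 8) ^ n"
      using s(2) by (simp add: power_one_over)
  qed (use s0 in \<open>auto intro!: LIMSEQ_power_zero\<close>)
  then have "(\<lambda>n. C * s n) \<longlonglongrightarrow> 0"
    using tendsto_mult_left[of s 0 sequentially C] by simp
  then obtain n where n: "C * s n < 1 / 2"
    using order_tendstoD(2)[of "\<lambda>n. C * s n" 0 sequentially "1 / 2"] eventually_happens
    by (metis half_gt_zero less_numeral_extra(1) sequentially_bot)
  \<comment> \<open>So \<open>T n\<close> lies within 1/2 of 0 and strictly within 1/2 of 1.\<close>
  have "cmod (T n) \<le> 1 / 2"
    using bound[of n] \<open>0 < \<epsilon>\<close> by (simp add: \<epsilon>_def) (smt (verit) divide_nonneg_nonneg zero_le_power)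
  moreover have "cmod (T n - 1) < 1 / 2"
    using one[of n] n by (auto simp: T_def)
  ultimately show False
    using norm_triangle_ineq4[of "T n" "T n - 1"] by simp
qed

section \<open>Dimension and separation of points\<close>

lemma zero_mem: "(\<lambda>_. 0) \<in> L"
  using smult[OF const_one, of 0] by simp

lemma abelian_monoid_alg: "abelian_monoid alg"
proof (rule abelian_monoidI, goal_cases)
  case 2
  then show ?case
    by (simp add: alg_def zero_mem)
qed (simp_all add: alg_def add ac_simps)

lemma finsum_alg:
  assumes "finite S" "S \<subseteq> L"
  shows "(\<Oplus>\<^bsub>alg\<^esub>s\<in>S. c s \<odot>\<^bsub>alg\<^esub> s) = (\<lambda>x. \<Sum>s\<in>S. c s * s x)"
proof -
  interpret abelian_monoid alg
    by (rule abelian_monoid_alg)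
  show ?thesis
    using assms
  proof (induction S)
    case empty
    show ?case
      by (simp del: alg_simps) (simp add: alg_def)
  next
    case (insert s S)
    then have "(\<lambda>s. c s \<odot>\<^bsub>alg\<^esub> s) \<in> S \<rightarrow> carrier alg"
      by (auto simp: smult)
    then show ?case
      using insert by (subst finsum_insert) (auto simp: smult)
  qed
qed

text \<open>Multiply the factors \<open>(h - h q) / (h y - h q)\<close>, one for each
  \<open>q\<close>, as in Lagrange interpolation.\<close>

lemma Lagrange:
  assumes "finite Q" and "\<And>q. q \<in> Q \<Longrightarrow> \<exists>h \<in> L. h y \<noteq> h q"
  shows "\<exists>e \<in> L. e y = 1 \<and> (\<forall>q \<in> Q. e q = 0)"
  using assms
proof (induction Q)
  case empty
  then show ?case
    using const_one by (intro bexI[of _ "\<lambda>_. 1"]) auto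
next
  case (insert q Q)
  then obtain e where e: "e \<in> L" "e y = 1" "\<forall>q \<in> Q. e q = 0"
    by auto
  obtain h where h: "h \<in> L" "h y \<noteq> h q"
    using insert.prems by blast
  have "(\<lambda>x. 1 / (h y - h q) * (h x + (- h q) * 1)) \<in> L"
    using h by (intro smult add const_one)
  from mult[OF e(1) this] e(2,3) h(2) show ?case
    by (intro bexI) auto
qed

text \<open>Choose one representative in each class of points that \<open>L\<close> does not
  separate. If there were finitely many classes, the Lagrange functions of the representatives would
  span \<open>L\<close>.\<close>

lemma infinite_separated_set:
  assumes "\<not> finite_dimensional alg"
  shows "\<exists>Y. infinite Y \<and> (\<forall>x \<in> Y. \<forall>y \<in> Y. x \<noteq> y \<longrightarrow> (\<exists>h \<in> L. h x \<noteq> h y))"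
proof -
  define rep where "rep x = (SOME y. \<forall>h \<in> L. h y = h x)" for x
  have rep: "h (rep x) = h x" if "h \<in> L" for h x
    using someI[of "\<lambda>y. \<forall>h \<in> L. h y = h x" x] that by (simp add: rep_def)
  have sep: "\<exists>h \<in> L. h x \<noteq> h y" if xy: "x \<in> range rep" "y \<in> range rep" "x \<noteq> y" for x y
  proof (rule ccontr)
    assume same: "\<not> (\<exists>h \<in> L. h x \<noteq> h y)"
    obtain x' y' where x': "x = rep x'" and y': "y = rep y'"
      using xy by blast
    have eq: "h x' = h y'" if "h \<in> L" for h
      using same that rep x' y' by metis
    \<comment> \<open>The chosen representative depends only on this predicate, hence only on the
      class.\<close>
    have "(\<lambda>y. \<forall>h \<in> L. h y = h x') = (\<lambda>y. \<forall>h \<in> L. h y = h y')"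
      by (intro ext ball_cong refl) (simp add: eq)
    then have "rep x' = rep y'"
      unfolding rep_def by (simp only:)
    with xy(3) x' y' show False by simp
  qed
  have "infinite (range rep)"
  proof
    assume fin: "finite (range rep)"
    have "\<exists>e \<in> L. e y = 1 \<and> (\<forall>q \<in> range rep - {y}. e q = 0)" if "y \<in> range rep" for y
      using that sep fin by (intro Lagrange) auto
    then obtain e where e: "\<And>y. y \<in> range rep \<Longrightarrow> e y \<in> L \<and> e y y = 1 \<and> (\<forall>q \<in> range rep - {y}. e y q = 0)"
      by metis
    \<comment> \<open>\<open>finite_dimensional\<close> indexes coefficients by the spanning
      functions, so each function must determine its representative.\<close>
    have inj: "inj_on e (range rep)"
      by (rule inj_onI) (metis DiffI e singletonD zero_neq_one)
    have "finite_dimensional alg"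
      unfolding finite_dimensional_def
    proof (intro exI conjI ballI)
      show "finite (e ` range rep)" "e ` range rep \<subseteq> carrier alg"
        using fin e by auto
      fix v assume "v \<in> carrier alg"
      then have v: "v \<in> L" by simp
      let ?c = "\<lambda>s. v (inv_into (range rep) e s)"
      have "(\<Sum>s \<in> e ` range rep. ?c s * s x) = v x" for x
      proof -
        have "(\<Sum>s \<in> e ` range rep. ?c s * s x) = (\<Sum>y \<in> range rep. ?c (e y) * e y x)"
          using inj by (simp add: sum.reindex)
        also have "\<dots> = (\<Sum>y \<in> range rep. v y * e y (rep x))"
        proof (rule sum.cong[OF refl])
          fix y assume y: "y \<in> range rep"
          then have "e y (rep x) = e y x"
            using e by (intro rep) blast
          with y inj show "?c (e y) * e y x = v y * e y (rep x)"
            by simp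
        qed
        also have "\<dots> = (\<Sum>y \<in> range rep. if y = rep x then v y else 0)"
          using e by (intro sum.cong) auto
        also have "\<dots> = v x"
          using fin rep[OF v] by simp
        finally show ?thesis .
      qed
      then show "v = (\<Oplus>\<^bsub>alg\<^esub>s \<in> e ` range rep. ?c s \<odot>\<^bsub>alg\<^esub> s)"
        using fin e by (subst finsum_alg) auto
    qed
    with assms show False by simp
  qed
  with sep show ?thesis by blast
qed

end

section \<open>Little Lipschitz functions on a compact space\<close>

lemma cmod_lip_quotient:
  "cmod (lip_quotient \<alpha> f x y) = cmod (f x - f y) / dist x y powr \<alpha>"
  by (simp add: lip_quotient_def norm_mult norm_inverse powr_minus divide_inverse mult.commute)

lemma cmod_lip_quotient_le_iff:
  assumes "x \<noteq> y"
  shows "cmod (lip_quotient \<alpha> f x y) \<le> C \<longleftrightarrow> cmod (f x - f y) \<le> C * dist x y powr \<alpha>"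
proof -
  have "0 < dist x y powr \<alpha>"
    using assms by simp
  then show ?thesis
    by (simp only: cmod_lip_quotient pos_divide_le_eq)
qed

lemma lip_seminorm_bound:
  assumes "f \<in> big_lip \<alpha>"
  shows "cmod (f x - f y) \<le> lip_seminorm \<alpha> f * dist x y powr \<alpha>"
proof (cases "x = y")
  case False
  have "cmod (lip_quotient \<alpha> f x y) \<le> lip_seminorm \<alpha> f"
    unfolding lip_seminorm_def using assms False
    by (intro cSUP_upper2[where x = "(x, y)"]) (auto simp: big_lip_def)
  with False show ?thesis
    by (simp add: cmod_lip_quotient_le_iff)
qed simp

text \<open>Two distinct points make the supremum range over a nonempty set; over the empty set it
  has no useful value.\<close>

lemma lip_seminorm_le:
  fixes f :: "'a::metric_space \<Rightarrow> complex"
  assumes "x0 \<noteq> (y0 :: 'a)" and "\<And>x y. cmod (f x - f y) \<le> C * dist x y powr \<alpha>"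
  shows "lip_seminorm \<alpha> f \<le> C"
  unfolding lip_seminorm_def
proof (rule cSUP_least)
  show "{(x, y). x \<noteq> (y :: 'a)} \<noteq> {}"
    using assms(1) by blast
qed (use assms(2) in \<open>auto simp: cmod_lip_quotient_le_iff\<close>)

text \<open>On a compact space, smallness at short distances yields continuity, hence a bound
  \<open>B\<close> for \<open>f\<close>, and pairs at distance at least \<delta> have quotient at
  most \<open>2 * B / \<delta> powr \<alpha>\<close>. The version without division also covers
  \<open>x = y\<close>.\<close>

lemma little_lip_iff:
  fixes f :: "'a::metric_space \<Rightarrow> complex"
  assumes X: "compact (UNIV :: 'a set)" and \<alpha>: "0 < \<alpha>"
  shows "f \<in> little_lip \<alpha> \<longleftrightarrow>
    (\<forall>\<epsilon>>0. \<exists>\<delta>>0. \<forall>x y. dist x y < \<delta> \<longrightarrow> cmod (f x - f y) \<le> \<epsilon> * dist x y powr \<alpha>)" (is "_ \<longleftrightarrow> ?R")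
proof
  assume f: "f \<in> little_lip \<alpha>"
  show ?R
  proof (intro allI impI)
    fix \<epsilon> :: real assume "\<epsilon> > 0"
    then obtain \<delta> where \<delta>: "\<delta> > 0" "\<And>x y. x \<noteq> y \<Longrightarrow> dist x y < \<delta> \<Longrightarrow> cmod (lip_quotient \<alpha> f x y) < \<epsilon>"
      using f unfolding little_lip_def by blast
    have "cmod (f x - f y) \<le> \<epsilon> * dist x y powr \<alpha>" if "dist x y < \<delta>" for x y
      using \<delta>(2)[of x y] that cmod_lip_quotient_le_iff[of x y \<alpha> f \<epsilon>] by (cases "x = y") auto
    with \<delta>(1) show "\<exists>\<delta>>0. \<forall>x y. dist x y < \<delta> \<longrightarrow> cmod (f x - f y) \<le> \<epsilon> * dist x y powr \<alpha>"
      by blast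
  qed
next
  assume R: ?R
  then obtain \<delta> where \<delta>: "\<delta> > 0" "\<And>x y. dist x y < \<delta> \<Longrightarrow> cmod (f x - f y) \<le> 1 * dist x y powr \<alpha>"
    using zero_less_one by blast
  have cont: "continuous_on UNIV f"
    unfolding continuous_on_iff
  proof (intro ballI allI impI)
    fix x :: 'a and e :: real assume e: "0 < e"
    have "dist (f y) (f x) < e" if "dist y x < min \<delta> (e powr (1 / \<alpha>))" for y
    proof -
      have "dist y x powr \<alpha> < (e powr (1 / \<alpha>)) powr \<alpha>"
        using that \<alpha> by (intro powr_less_mono2) auto
      then show ?thesis
        using \<delta>(2)[of y x] that \<alpha> e by (simp add: powr_powr dist_norm)
    qed
    then show "\<exists>d>0. \<forall>y\<in>UNIV. dist y x < d \<longrightarrow> dist (f y) (f x) < e"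
      using \<delta>(1) e by (intro exI[of _ "min \<delta> (e powr (1 / \<alpha>))"]) auto
  qed
  obtain B where B: "\<And>x. cmod (f x) \<le> B"
    using compact_imp_bounded[OF compact_continuous_image[OF cont X]] by (auto simp: bounded_iff)
  have "cmod (lip_quotient \<alpha> f x y) \<le> max 1 (2 * B / \<delta> powr \<alpha>)" if "x \<noteq> y" for x y
  proof (cases "dist x y < \<delta>")
    case True
    with that \<delta>(2)[OF True] cmod_lip_quotient_le_iff[of x y \<alpha> f 1] show ?thesis
      by simp
  next
    case False
    have "cmod (f x - f y) \<le> 2 * B"
      using norm_triangle_ineq4[of "f x" "f y"] B[of x] B[of y] by simp
    moreover have "\<delta> powr \<alpha> \<le> dist x y powr \<alpha>"
      using False \<delta>(1) \<alpha> by (intro powr_mono2) auto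
    moreover have "0 \<le> B"
      using B[of x] norm_ge_zero order_trans by blast
    ultimately have "cmod (f x - f y) / dist x y powr \<alpha> \<le> 2 * B / \<delta> powr \<alpha>"
      using \<delta>(1) by (intro frac_le) auto
    then show ?thesis
      by (simp add: cmod_lip_quotient)
  qed
  then have "f \<in> big_lip \<alpha>"
    unfolding big_lip_def using cont by (auto intro!: bdd_aboveI2)
  moreover have "\<exists>\<delta>>0. \<forall>x y. x \<noteq> y \<and> dist x y < \<delta> \<longrightarrow> cmod (lip_quotient \<alpha> f x y) < \<epsilon>" if "\<epsilon> > 0" for \<epsilon>
  proof -
    \<comment> \<open>Halving \<epsilon> turns the weak inequality into the strict one of the
      definition.\<close>
    obtain \<delta> where "\<delta> > 0" "\<And>x y. dist x y < \<delta> \<Longrightarrow> cmod (f x - f y) \<le> \<epsilon> / 2 * dist x y powr \<alpha>"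
      using R half_gt_zero[OF \<open>\<epsilon> > 0\<close>] by blast
    moreover have "cmod (lip_quotient \<alpha> f x y) < \<epsilon>"
      if "x \<noteq> y" "cmod (f x - f y) \<le> \<epsilon> / 2 * dist x y powr \<alpha>" for x y
      using cmod_lip_quotient_le_iff[OF that(1), of \<alpha> f "\<epsilon> / 2"] that(2) \<open>\<epsilon> > 0\<close> by linarith
    ultimately show ?thesis by blast
  qed
  ultimately show "f \<in> little_lip \<alpha>"
    unfolding little_lip_def by blast
qed

text \<open>One criterion for sums, products, scalar multiples and lattice operations: each has
  increments dominated by those of its ingredients.\<close>

lemma little_lip_dominated:
  fixes f g h :: "'a::metric_space \<Rightarrow> complex"
  assumes X: "compact (UNIV :: 'a set)" and \<alpha>: "0 < \<alpha>"
    and f: "f \<in> little_lip \<alpha>" and g: "g \<in> little_lip \<alpha>" and "0 \<le> A" "0 \<le> B"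
    and le: "\<And>x y. cmod (h x - h y) \<le> A * cmod (f x - f y) + B * cmod (g x - g y)"
  shows "h \<in> little_lip \<alpha>"
  unfolding little_lip_iff[OF X \<alpha>]
proof (intro allI impI)
  fix \<epsilon> :: real assume \<epsilon>: "\<epsilon> > 0"
  \<comment> \<open>The summand 1 keeps the divisor positive when \<open>A = B = 0\<close>.\<close>
  define \<eta> where "\<eta> = \<epsilon> / (A + B + 1)"
  have \<eta>: "\<eta> > 0" "(A + B) * \<eta> \<le> \<epsilon>"
    using \<epsilon> assms(5,6) by (auto simp: \<eta>_def field_simps)
  obtain d1 where d1: "d1 > 0" "\<And>x y. dist x y < d1 \<Longrightarrow> cmod (f x - f y) \<le> \<eta> * dist x y powr \<alpha>"
    using f \<eta>(1) unfolding little_lip_iff[OF X \<alpha>] by blast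
  obtain d2 where d2: "d2 > 0" "\<And>x y. dist x y < d2 \<Longrightarrow> cmod (g x - g y) \<le> \<eta> * dist x y powr \<alpha>"
    using g \<eta>(1) unfolding little_lip_iff[OF X \<alpha>] by blast
  have "cmod (h x - h y) \<le> \<epsilon> * dist x y powr \<alpha>" if "dist x y < min d1 d2" for x y
  proof -
    have "cmod (h x - h y) \<le> A * (\<eta> * dist x y powr \<alpha>) + B * (\<eta> * dist x y powr \<alpha>)"
      using le[of x y] mult_left_mono[OF d1(2)[of x y] assms(5)] mult_left_mono[OF d2(2)[of x y] assms(6)] that
      by simp
    also have "\<dots> = (A + B) * \<eta> * dist x y powr \<alpha>"
      by (simp add: algebra_simps)
    also have "\<dots> \<le> \<epsilon> * dist x y powr \<alpha>"
      using \<eta>(2) by (intro mult_right_mono) auto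
    finally show ?thesis .
  qed
  with d1(1) d2(1) show "\<exists>\<delta>>0. \<forall>x y. dist x y < \<delta> \<longrightarrow> cmod (h x - h y) \<le> \<epsilon> * dist x y powr \<alpha>"
    by (intro exI[of _ "min d1 d2"]) auto
qed

lemma bdd_above_cmod_little_lip:
  fixes f :: "'a::metric_space \<Rightarrow> complex"
  assumes "compact (UNIV :: 'a set)" and "f \<in> little_lip \<alpha>"
  shows "bdd_above (range (\<lambda>x. cmod (f x)))"
proof -
  have "continuous_on UNIV f"
    using assms(2) by (simp add: little_lip_def big_lip_def)
  from compact_imp_bounded[OF compact_continuous_image[OF this assms(1)]]
  show ?thesis
    by (auto simp: bounded_iff bdd_above_def)
qed

lemma little_lip_function_algebra:
  assumes X: "compact (UNIV :: 'a::metric_space set)" "infinite (UNIV :: 'a set)" and \<alpha>: "0 < \<alpha>"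
  shows "function_algebra (little_lip \<alpha> :: ('a \<Rightarrow> complex) set) (\<lambda>f. (SUP x. cmod (f x)) + lip_seminorm \<alpha> f)"
proof -
  obtain x0 y0 :: 'a where ne: "x0 \<noteq> y0"
    using X(2) by (metis UNIV_eq_I finite.emptyI finite.insertI insertI1)
  note dom = little_lip_dominated[OF X(1) \<alpha>]
  let ?M = "\<lambda>f :: 'a \<Rightarrow> complex. SUP x. cmod (f x)"
  have pt: "cmod (f x) \<le> ?M f" if "f \<in> little_lip \<alpha>" for f x
    by (rule cSUP_upper[OF UNIV_I bdd_above_cmod_little_lip[OF X(1) that]])
  then have M: "0 \<le> ?M f" if "f \<in> little_lip \<alpha>" for f
    using that norm_ge_zero order_trans by blast
  have lip: "cmod (f x - f y) \<le> lip_seminorm \<alpha> f * dist x y powr \<alpha>" if "f \<in> little_lip \<alpha>" for f and x y :: 'a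
    using lip_seminorm_bound that by (auto simp: little_lip_def)
  have p: "0 \<le> lip_seminorm \<alpha> f" if "f \<in> little_lip \<alpha>" for f :: "'a \<Rightarrow> complex"
  proof -
    have "0 \<le> lip_seminorm \<alpha> f * dist x0 y0 powr \<alpha>"
      using lip[OF that, of x0 y0] norm_ge_zero order_trans by blast
    with ne show ?thesis
      by (simp add: zero_le_mult_iff)
  qed
  have prod: "cmod (f x * g x - f y * g y) \<le> ?M g * cmod (f x - f y) + ?M f * cmod (g x - g y)"
    if "f \<in> little_lip \<alpha>" "g \<in> little_lip \<alpha>" for f g x y
  proof -
    have "f x * g x - f y * g y = g x * (f x - f y) + f y * (g x - g y)"
      by (simp add: algebra_simps)
    then have "cmod (f x * g x - f y * g y) \<le> cmod (g x) * cmod (f x - f y) + cmod (f y) * cmod (g x - g y)"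
      by (metis norm_mult norm_triangle_ineq)
    also have "\<dots> \<le> ?M g * cmod (f x - f y) + ?M f * cmod (g x - g y)"
      using pt that by (intro add_mono mult_right_mono) auto
    finally show ?thesis .
  qed
  show ?thesis
  proof
    show one: "(\<lambda>_ :: 'a. 1) \<in> little_lip \<alpha>"
      unfolding little_lip_iff[OF X(1) \<alpha>] by (auto intro: exI[of _ 1])
    fix f g :: "'a \<Rightarrow> complex" assume f: "f \<in> little_lip \<alpha>" and g: "g \<in> little_lip \<alpha>"
    show "(\<lambda>x. f x + g x) \<in> little_lip \<alpha>"
      by (rule dom[OF f g, of 1 1]) (auto simp: algebra_simps intro: order_trans[OF _ norm_triangle_ineq])
    show fg: "(\<lambda>x. f x * g x) \<in> little_lip \<alpha>"
      by (rule dom[OF f g M[OF g] M[OF f] prod[OF f g]])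
    have "?M (\<lambda>x. f x * g x) \<le> ?M f * ?M g"
      using pt M f g by (intro cSUP_least) (auto simp: norm_mult intro!: mult_mono)
    moreover have "lip_seminorm \<alpha> (\<lambda>x. f x * g x) \<le> ?M g * lip_seminorm \<alpha> f + ?M f * lip_seminorm \<alpha> g"
    proof (rule lip_seminorm_le[OF ne])
      fix x y :: 'a
      have "cmod (f x * g x - f y * g y) \<le> ?M g * (lip_seminorm \<alpha> f * dist x y powr \<alpha>) + ?M f * (lip_seminorm \<alpha> g * dist x y powr \<alpha>)"
        using prod[OF f g, of x y] mult_left_mono[OF lip[OF f, of x y] M[OF g]]
          mult_left_mono[OF lip[OF g, of x y] M[OF f]] by linarith
      then show "cmod (f x * g x - f y * g y) \<le> (?M g * lip_seminorm \<alpha> f + ?M f * lip_seminorm \<alpha> g) * dist x y powr \<alpha>"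
        by (simp add: algebra_simps)
    qed
    \<comment> \<open>This is the one term of the expanded product of norms that the two previous
      estimates leave over.\<close>
    moreover have "0 \<le> lip_seminorm \<alpha> f * lip_seminorm \<alpha> g"
      using p f g by simp
    ultimately show "?M (\<lambda>x. f x * g x) + lip_seminorm \<alpha> (\<lambda>x. f x * g x)
        \<le> (?M f + lip_seminorm \<alpha> f) * (?M g + lip_seminorm \<alpha> g)"
      by (simp add: algebra_simps)
  next
    fix f :: "'a \<Rightarrow> complex" and c assume f: "f \<in> little_lip \<alpha>"
    show "(\<lambda>x. c * f x) \<in> little_lip \<alpha>"
      by (rule dom[OF f f, of "cmod c" 0]) (simp_all add: norm_mult flip: right_diff_distrib)
  next
    fix f :: "'a \<Rightarrow> complex" and x assume f: "f \<in> little_lip \<alpha>"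
    show "cmod (f x) \<le> ?M f + lip_seminorm \<alpha> f"
      using pt[OF f, of x] p[OF f] by simp
  qed
qed

section \<open>The distance from a point as seen by little Lipschitz functions\<close>

text \<open>Real nonnegative functions admit maxima, minima and truncation. Nothing is lost by
  restricting to them: for \<open>h\<close> in \<open>little_lip \<alpha>\<close> with positive
  seminorm, \<open>|h - h p|\<close> divided by the seminorm belongs to this set.\<close>

definition lip_cone :: "real \<Rightarrow> 'a::metric_space \<Rightarrow> ('a \<Rightarrow> real) set" where
  "lip_cone \<alpha> p = {g. (\<lambda>x. complex_of_real (g x)) \<in> little_lip \<alpha> \<and> (\<forall>x. 0 \<le> g x) \<and> g p = 0 \<and>
     (\<forall>x y. \<bar>g x - g y\<bar> \<le> dist x y powr \<alpha>)}"

text \<open>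
  For \<open>\<alpha> = 1\<close> little Lipschitz functions may be scarce and even fail to separate points, so the
  distance from \<open>p\<close> has to be measured by these functions and not by \<open>dist\<close>.
\<close>

definition lip_dist :: "real \<Rightarrow> 'a::metric_space \<Rightarrow> 'a \<Rightarrow> real" where
  "lip_dist \<alpha> p x = (SUP g \<in> lip_cone \<alpha> p. g x)"

text \<open>The parameter \<open>X\<close> fixes the type \<open>'a\<close>, which \<alpha> does not
  mention.\<close>

locale compact_lip =
  fixes \<alpha> :: real and X :: "'a::metric_space itself"
  assumes compact: "compact (UNIV :: 'a set)" and infinite: "infinite (UNIV :: 'a set)" and pos: "0 < \<alpha>"
begin

sublocale function_algebra "little_lip \<alpha> :: ('a \<Rightarrow> complex) set"
    "\<lambda>f. (SUP x. cmod (f x)) + lip_seminorm \<alpha> f"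
  by (rule little_lip_function_algebra[OF compact infinite pos])

lemma alg_eq: "alg = little_lip_algebra \<alpha>"
  by (simp add: alg_def little_lip_algebra_def)

lemma zero_in_lip_cone: "(\<lambda>_. 0) \<in> lip_cone \<alpha> (p :: 'a)"
  using zero_mem by (simp add: lip_cone_def)

lemma lip_cone_le:
  assumes "g \<in> lip_cone \<alpha> p"
  shows "g x \<le> dist x p powr \<alpha>"
proof -
  have "g p = 0" "\<bar>g x - g p\<bar> \<le> dist x p powr \<alpha>"
    using assms unfolding lip_cone_def by blast+
  then show ?thesis by linarith
qed

lemma lip_cone_upper:
  fixes p x :: 'a
  assumes "g \<in> lip_cone \<alpha> p"
  shows "g x \<le> lip_dist \<alpha> p x"
  unfolding lip_dist_def using lip_cone_le by (intro cSUP_upper[OF assms] bdd_aboveI2)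

lemma lip_dist_nonneg: "0 \<le> lip_dist \<alpha> p (x :: 'a)"
  using lip_cone_upper[OF zero_in_lip_cone] by simp

lemma lip_dist_le: "lip_dist \<alpha> p (x :: 'a) \<le> dist x p powr \<alpha>"
  unfolding lip_dist_def
proof (rule cSUP_least)
  show "lip_cone \<alpha> p \<noteq> {}"
    using zero_in_lip_cone by blast
qed (rule lip_cone_le)

lemma lip_dist_approx:
  fixes p x :: 'a
  assumes "c < lip_dist \<alpha> p x"
  obtains g where "g \<in> lip_cone \<alpha> p" "c < g x"
proof -
  have "bdd_above ((\<lambda>g. g x) ` lip_cone \<alpha> p)"
    using lip_cone_upper by (intro bdd_aboveI2)
  then show thesis
    using assms that less_cSUP_iff[of "lip_cone \<alpha> p" "\<lambda>g. g x" c] zero_in_lip_cone[of p]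
    unfolding lip_dist_def by blast
qed

text \<open>The function \<open>|h - h p|\<close>, divided by the seminorm of \<open>h\<close>, lies
  in \<open>lip_cone \<alpha> p\<close>. This makes \<open>lip_dist\<close> a bound for the norm of
  \<open>h \<mapsto> h x - h p\<close>.\<close>

lemma lip_dist_bound:
  fixes p x :: 'a and h :: "'a \<Rightarrow> complex"
  assumes h: "h \<in> little_lip \<alpha>"
  shows "cmod (h x - h p) \<le> lip_dist \<alpha> p x * lip_seminorm \<alpha> h"
proof -
  let ?q = "lip_seminorm \<alpha> h"
  have q: "cmod (h x - h y) \<le> ?q * dist x y powr \<alpha>" for x y
    using lip_seminorm_bound h by (auto simp: little_lip_def)
  show ?thesis
  proof (cases "?q > 0")
    case True
    define g where "g x = cmod (h x - h p) / ?q" for x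
    have diff: "\<bar>g x - g y\<bar> \<le> cmod (h x - h y) / ?q" for x y
    proof -
      have "\<bar>cmod (h x - h p) - cmod (h y - h p)\<bar> \<le> cmod (h x - h y)"
        using norm_triangle_ineq3[of "h x - h p" "h y - h p"] by simp
      with True show ?thesis
        by (simp add: g_def divide_right_mono flip: diff_divide_distrib)
    qed
    have "\<bar>g x - g y\<bar> \<le> dist x y powr \<alpha>" for x y
    proof -
      have "cmod (h x - h y) / ?q \<le> dist x y powr \<alpha>"
        using q[of x y] True by (simp add: pos_divide_le_eq mult.commute)
      with diff[of x y] show ?thesis by linarith
    qed
    moreover have "(\<lambda>x. complex_of_real (g x)) \<in> little_lip \<alpha>"
    proof (rule little_lip_dominated[OF compact pos h h, of "1 / ?q" 0])
      show "cmod (complex_of_real (g x) - complex_of_real (g y)) \<le> 1 / ?q * cmod (h x - h y) + 0 * cmod (h x - h y)" for x y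
        using diff[of x y] by (simp flip: of_real_diff)
    qed (use True in auto)
    moreover have "0 \<le> g x" "g p = 0" for x
      using True by (simp_all add: g_def)
    ultimately have "g \<in> lip_cone \<alpha> p"
      by (simp add: lip_cone_def)
    from lip_cone_upper[OF this, of x] True show ?thesis
      by (simp add: g_def pos_divide_le_eq mult.commute)
  next
    case False
    \<comment> \<open>Without a positive seminorm \<open>h\<close> is constant, so there is nothing
      to normalise.\<close>
    have "h x = h p"
    proof -
      have "?q * dist x p powr \<alpha> \<le> 0"
        using False by (simp add: mult_nonpos_nonneg)
      then show ?thesis
        using q[of x p] norm_ge_zero[of "h x - h p"] by (smt (verit) eq_iff_diff_eq_0 norm_le_zero_iff)
    qed
    moreover have "0 \<le> ?q"
    proof -
      obtain x y :: 'a where "x \<noteq> y"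
        using infinite by (metis UNIV_eq_I finite.emptyI finite.insertI insertI1)
      moreover have "0 \<le> ?q * dist x y powr \<alpha>"
        using q[of x y] norm_ge_zero order_trans by blast
      ultimately show ?thesis
        by (simp add: zero_le_mult_iff)
    qed
    ultimately show ?thesis
      using lip_dist_nonneg by simp
  qed
qed

text \<open>Applied to maxima, minima and truncations of \<open>f\<close> and \<open>g\<close>. The
  maximum of the increments, rather than their sum, keeps the Lipschitz constant at 1.\<close>

lemma lip_cone_clamp:
  fixes p :: 'a
  assumes "f \<in> lip_cone \<alpha> p" "g \<in> lip_cone \<alpha> p"
    and "\<And>x. 0 \<le> e x" "e p = 0" and "\<And>x y. \<bar>e x - e y\<bar> \<le> max \<bar>f x - f y\<bar> \<bar>g x - g y\<bar>"
  shows "e \<in> lip_cone \<alpha> p"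
proof -
  have "(\<lambda>x. complex_of_real (e x)) \<in> little_lip \<alpha>"
  proof (rule little_lip_dominated[OF compact pos, of "\<lambda>x. complex_of_real (f x)" "\<lambda>x. complex_of_real (g x)" 1 1])
    show "cmod (complex_of_real (e x) - complex_of_real (e y)) \<le>
      1 * cmod (complex_of_real (f x) - complex_of_real (f y)) + 1 * cmod (complex_of_real (g x) - complex_of_real (g y))" for x y
      using assms(5)[of x y] by (simp flip: of_real_diff)
  qed (use assms in \<open>auto simp: lip_cone_def\<close>)
  moreover have "\<bar>e x - e y\<bar> \<le> dist x y powr \<alpha>" for x y
    using assms(1,2) assms(5)[of x y] by (auto simp: lip_cone_def le_max_iff_disj intro: order_trans)
  ultimately show ?thesis
    using assms by (simp add: lip_cone_def)
qed

text \<open>A bump at \<open>x\<close> that is killed at the finitely many points of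
  \<open>Q\<close>, which lie farther from \<open>p\<close>, and wherever \<open>lip_dist\<close> is
  small.\<close>

lemma lip_bump:
  fixes p x :: 'a
  assumes x: "0 < lip_dist \<alpha> p x" and Q: "finite Q" "\<And>q. q \<in> Q \<Longrightarrow> 8 * lip_dist \<alpha> p x \<le> lip_dist \<alpha> p q"
  obtains e where "e \<in> lip_cone \<alpha> p" "lip_dist \<alpha> p x / 4 \<le> e x" "\<And>q. q \<in> Q \<Longrightarrow> e q = 0"
    "\<And>y. lip_dist \<alpha> p y \<le> lip_dist \<alpha> p x / 4 \<Longrightarrow> e y = 0" "\<And>y. e y \<le> 2 * lip_dist \<alpha> p x"
proof -
  let ?r = "lip_dist \<alpha> p x"
  \<comment> \<open>A finite maximum of cone functions, each exceeding \<open>2 * ?r\<close> at one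
    point of \<open>Q\<close>; the hypothesis with factor 8 leaves ample room.\<close>
  have "\<exists>f \<in> lip_cone \<alpha> p. \<forall>q \<in> Q. 2 * ?r \<le> f q"
    using Q
  proof (induction Q)
    case empty
    then show ?case
      using zero_in_lip_cone by blast
  next
    case (insert q Q)
    then obtain f where f: "f \<in> lip_cone \<alpha> p" "\<forall>q \<in> Q. 2 * ?r \<le> f q"
      by auto
    have "2 * ?r < lip_dist \<alpha> p q"
      using insert.prems[of q] x by simp
    then obtain g where g: "g \<in> lip_cone \<alpha> p" "2 * ?r < g q"
      by (rule lip_dist_approx)
    have "(\<lambda>y. max (f y) (g y)) \<in> lip_cone \<alpha> p"
      using f(1) g(1) by (intro lip_cone_clamp[OF f(1) g(1)]) (auto simp: lip_cone_def max_def)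
    with f(2) g(2) show ?case
      by (intro bexI[of _ "\<lambda>y. max (f y) (g y)"]) auto
  qed
  then obtain f where f: "f \<in> lip_cone \<alpha> p" "\<And>q. q \<in> Q \<Longrightarrow> 2 * ?r \<le> f q"
    by blast
  obtain g where g: "g \<in> lip_cone \<alpha> p" "?r / 2 < g x"
    using lip_dist_approx[of "?r / 2" p x] x by auto
  note upper = lip_cone_upper[OF f(1)] lip_cone_upper[OF g(1)]
  \<comment> \<open>Lowering \<open>g\<close> by \<open>?r / 4\<close> kills it where
    \<open>lip_dist\<close> is at most \<open>?r / 4\<close>, and the cap \<open>2 * ?r - f\<close>
    kills it on \<open>Q\<close>. At \<open>x\<close> the first term exceeds \<open>?r / 4\<close>
    and the cap is at least \<open>?r\<close>, because \<open>f x \<le> ?r\<close>.\<close>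
  define e where "e y = max 0 (min (g y - ?r / 4) (2 * ?r - f y))" for y
  show thesis
  proof (rule that[of e])
    show "e \<in> lip_cone \<alpha> p"
      using g(1) x by (intro lip_cone_clamp[OF f(1) g(1)]) (auto simp: e_def lip_cone_def max_def min_def)
    show "?r / 4 \<le> e x"
      using g(2) upper(1)[of x] x by (auto simp: e_def)
    show "e q = 0" if "q \<in> Q" for q
      using f(2)[OF that] by (auto simp: e_def)
    show "e y = 0" if "lip_dist \<alpha> p y \<le> ?r / 4" for y
      using upper(2)[of y] that by (auto simp: e_def)
    show "e y \<le> 2 * ?r" for y
    proof -
      have "0 \<le> f y"
        using f(1) by (simp add: lip_cone_def)
      with x show ?thesis
        by (simp add: e_def min_le_iff_disj)
    qed
  qed
qed

section \<open>Functions supported on part of a sequence\<close>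

text \<open>Partial sums are little Lipschitz, and the weights make the Lipschitz constant of the
  tail from \<open>K\<close> on at most \<open>2 / 2 ^ K\<close>, so the limit inherits the
  condition. The bound 2 makes the series converge pointwise.\<close>

lemma series_in_little_lip:
  fixes e :: "nat \<Rightarrow> 'a \<Rightarrow> real"
  assumes e: "\<And>k. e k \<in> lip_cone \<alpha> p" "\<And>k y. e k y \<le> 2"
  shows "(\<lambda>y. complex_of_real (\<Sum>k. if P k then e k y / 2 ^ k else 0)) \<in> little_lip \<alpha>"
proof -
  define t where "t k y = (if P k then e k y / 2 ^ k else 0)" for k y
  have geo: "summable (\<lambda>k. c * (1 / 2) ^ k :: real)" for c
    by (intro summable_mult summable_geometric) simp
  have summ: "summable (\<lambda>k. t k y)" for y
  proof (rule summable_comparison_test'[OF geo])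
    show "norm (t k y) \<le> 2 * (1 / 2) ^ k" for k
      using e(1)[of k] e(2)[of k y] by (auto simp: t_def lip_cone_def divide_simps power_one_over)
  qed
  have t_diff: "\<bar>t k x - t k y\<bar> \<le> dist x y powr \<alpha> * (1 / 2) ^ k" for k x y
  proof -
    have "\<bar>e k x - e k y\<bar> \<le> dist x y powr \<alpha>"
      using e(1)[of k] by (simp add: lip_cone_def)
    then show ?thesis
      by (auto simp: t_def power_one_over divide_right_mono simp flip: diff_divide_distrib)
  qed
  have t_lip: "(\<lambda>y. complex_of_real (t k y)) \<in> little_lip \<alpha>" for k
  proof (cases "P k")
    case True
    have "(\<lambda>y. complex_of_real (e k y)) \<in> little_lip \<alpha>"
      using e(1)[of k] by (simp add: lip_cone_def)
    from smult[OF this, of "1 / 2 ^ k"] True show ?thesis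
      by (simp add: t_def)
  next
    case False
    then show ?thesis
      using zero_mem by (simp add: t_def)
  qed
  have part_lip: "(\<lambda>y. complex_of_real (\<Sum>k<K. t k y)) \<in> little_lip \<alpha>" for K
    by (induction K) (use zero_mem add[OF _ t_lip] in simp_all)
  have tail: "\<bar>(\<Sum>k. t (k + K) x) - (\<Sum>k. t (k + K) y)\<bar> \<le> dist x y powr \<alpha> * (2 * (1 / 2) ^ K)" for K x y
  proof -
    have s: "summable (\<lambda>k. t (k + K) z)" for z
      by (rule summable_ignore_initial_segment[OF summ])
    have "\<bar>\<Sum>k. t (k + K) x - t (k + K) y\<bar> \<le> (\<Sum>k. (dist x y powr \<alpha> * (1 / 2) ^ K) * (1 / 2) ^ k)"
      using norm_suminf_le[OF _ geo, of "\<lambda>k. t (k + K) x - t (k + K) y" "dist x y powr \<alpha> * (1 / 2) ^ K"]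
        t_diff[of "_ + K" x y] by (simp add: power_add mult_ac)
    also have "\<dots> = (dist x y powr \<alpha> * (1 / 2) ^ K) * (\<Sum>k. (1 / 2) ^ k)"
      by (intro suminf_mult summable_geometric) simp
    also have "(\<Sum>k. (1 / 2) ^ k) = (2 :: real)"
      by (simp add: suminf_geometric)
    finally show ?thesis
      using suminf_diff[OF s s] by (simp add: mult_ac)
  qed
  have "(\<lambda>y. complex_of_real (\<Sum>k. t k y)) \<in> little_lip \<alpha>"
    unfolding little_lip_iff[OF compact pos]
  proof (intro allI impI)
    fix \<epsilon> :: real assume \<epsilon>: "\<epsilon> > 0"
    \<comment> \<open>The tail then takes at most half of \<epsilon>, leaving the other half for the
      partial sum.\<close>
    obtain K where K: "(1 / 2 :: real) ^ K < \<epsilon> / 4"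
      using real_arch_pow_inv[of "\<epsilon> / 4" "1 / 2"] \<epsilon> by auto
    obtain \<delta> where \<delta>: "\<delta> > 0" "\<And>x y. dist x y < \<delta> \<Longrightarrow>
        cmod (complex_of_real (\<Sum>k<K. t k x) - complex_of_real (\<Sum>k<K. t k y)) \<le> \<epsilon> / 2 * dist x y powr \<alpha>"
      using part_lip[of K] half_gt_zero[OF \<epsilon>] unfolding little_lip_iff[OF compact pos] by blast
    have "cmod (complex_of_real (\<Sum>k. t k x) - complex_of_real (\<Sum>k. t k y)) \<le> \<epsilon> * dist x y powr \<alpha>"
      if "dist x y < \<delta>" for x y
    proof -
      have "dist x y powr \<alpha> * (2 * (1 / 2) ^ K) \<le> dist x y powr \<alpha> * (\<epsilon> / 2)"
        using K by (intro mult_left_mono) auto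
      then have "\<bar>(\<Sum>k. t (k + K) x) - (\<Sum>k. t (k + K) y)\<bar> \<le> \<epsilon> / 2 * dist x y powr \<alpha>"
        using tail[of K x y] by (simp add: mult.commute)
      moreover have "\<bar>(\<Sum>k<K. t k x) - (\<Sum>k<K. t k y)\<bar> \<le> \<epsilon> / 2 * dist x y powr \<alpha>"
        using \<delta>(2)[OF that] unfolding of_real_diff[symmetric] norm_of_real .
      ultimately have "\<bar>(\<Sum>k. t k x) - (\<Sum>k. t k y)\<bar> \<le> \<epsilon> * dist x y powr \<alpha>"
        using suminf_split_initial_segment[OF summ, of x K] suminf_split_initial_segment[OF summ, of y K]
        by linarith
      then show ?thesis
        unfolding of_real_diff[symmetric] norm_of_real .
    qed
    with \<delta>(1) show "\<exists>\<delta>>0. \<forall>x y. dist x y < \<delta> \<longrightarrow>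
        cmod (complex_of_real (\<Sum>k. t k x) - complex_of_real (\<Sum>k. t k y)) \<le> \<epsilon> * dist x y powr \<alpha>"
      by blast
  qed
  then show ?thesis
    by (simp add: t_def)
qed

text \<open>Add bumps at the points with \<open>P\<close>, weighted by \<open>1 / 2 ^ k\<close>.
  Each bump vanishes at all other points of the sequence, so one term survives at
  \<open>x n\<close>; the 4 comes from the bump and \<open>2 ^ n\<close> from the weight.\<close>

lemma little_lip_prescribed_zeros:
  fixes p :: 'a and x :: "nat \<Rightarrow> 'a"
  assumes x0: "\<And>n. 0 < lip_dist \<alpha> p (x n)" and x1: "\<And>n. lip_dist \<alpha> p (x n) \<le> 1"
    and x8: "\<And>n. 8 * lip_dist \<alpha> p (x (Suc n)) \<le> lip_dist \<alpha> p (x n)"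
  shows "\<exists>f \<in> little_lip \<alpha>. f p = 0 \<and> (\<forall>n. \<not> P n \<longrightarrow> f (x n) = 0) \<and>
    (\<forall>n. P n \<longrightarrow> lip_dist \<alpha> p (x n) / (4 * 2 ^ n) \<le> cmod (f (x n)))"
proof -
  let ?s = "\<lambda>n. lip_dist \<alpha> p (x n)"
  have "decseq ?s"
    by (rule decseq_SucI) (use x8 x0 in \<open>smt (verit)\<close>)
  then have far: "8 * ?s k \<le> ?s i" if "i < k" for i k
    using x8[of i] decseqD[of ?s "Suc i" k] that by simp
  \<comment> \<open>Earlier points are at least 8 times as far from \<open>p\<close> and form
    \<open>Q\<close>; later ones are at most \<open>?s k / 8\<close> away and fall where the bump is
    0.\<close>
  have "\<exists>e. e \<in> lip_cone \<alpha> p \<and> ?s k / 4 \<le> e (x k) \<and> (\<forall>i. i \<noteq> k \<longrightarrow> e (x i) = 0) \<and> (\<forall>y. e y \<le> 2)" for k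
  proof (rule lip_bump[OF x0[of k], of "x ` {..<k}"])
    fix e assume e: "e \<in> lip_cone \<alpha> p" "?s k / 4 \<le> e (x k)" "\<And>q. q \<in> x ` {..<k} \<Longrightarrow> e q = 0"
      "\<And>y. lip_dist \<alpha> p y \<le> ?s k / 4 \<Longrightarrow> e y = 0" "\<And>y. e y \<le> 2 * ?s k"
    have "e (x i) = 0" if "i \<noteq> k" for i
    proof (cases "i < k")
      case True
      with e(3) show ?thesis by simp
    next
      case False
      then show ?thesis
        using far[of k i] x0[of i] that by (intro e(4)) simp
    qed
    moreover have "e y \<le> 2" for y
      using e(5)[of y] x1[of k] by simp
    ultimately show ?thesis
      using e by blast
  qed (use far in auto)
  then obtain e where e: "\<And>k. e k \<in> lip_cone \<alpha> p" "\<And>k. ?s k / 4 \<le> e k (x k)"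
    "\<And>k i. i \<noteq> k \<Longrightarrow> e k (x i) = 0" "\<And>k y. e k y \<le> 2"
    by metis
  define f where "f y = complex_of_real (\<Sum>k. if P k then e k y / 2 ^ k else 0)" for y
  have fx: "f (x n) = complex_of_real (if P n then e n (x n) / 2 ^ n else 0)" for n
    unfolding f_def
    by (subst suminf_finite[of "{n}"]) (use e(3) in auto)
  show ?thesis
  proof (intro bexI[of _ f] conjI allI impI)
    show "f \<in> little_lip \<alpha>"
      unfolding f_def by (rule series_in_little_lip[OF e(1,4)])
    have "e k p = 0" for k
      using e(1)[of k] by (simp add: lip_cone_def)
    then show "f p = 0"
      by (simp add: f_def cong: if_cong)
    show "f (x n) = 0" if "\<not> P n" for n
      using that by (simp add: fx)
    show "?s n / (4 * 2 ^ n) \<le> cmod (f (x n))" if "P n" for n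
    proof -
      have "?s n / (4 * 2 ^ n) \<le> e n (x n) / 2 ^ n"
        using e(2)[of n] by (simp add: field_simps)
      also have "\<dots> \<le> cmod (f (x n))"
        unfolding fx norm_of_real using that by (simp add: divide_right_mono)
      finally show ?thesis .
    qed
  qed
qed

section \<open>Choice of the base point and of the sequence\<close>

text \<open>Take a limit point \<open>p\<close> of \<open>Y\<close>. Near \<open>p\<close> the
  distance \<open>lip_dist\<close> is small because it is at most \<open>dist powr \<alpha>\<close>;
  it is positive somewhere in each ball because the ball contains two separated points.\<close>

lemma lip_dist_arbitrarily_small:
  fixes Y :: "'a set"
  assumes Y: "infinite Y" and sep: "\<And>x y. \<lbrakk>x \<in> Y; y \<in> Y; x \<noteq> y\<rbrakk> \<Longrightarrow> \<exists>h \<in> little_lip \<alpha>. h x \<noteq> h y"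
  obtains p :: 'a where "\<And>\<eta>. 0 < \<eta> \<Longrightarrow> \<exists>x. 0 < lip_dist \<alpha> p x \<and> lip_dist \<alpha> p x < \<eta>"
proof -
  obtain p where p: "p islimpt Y"
    using Heine_Borel_imp_Bolzano_Weierstrass[OF compact Y] by auto
  have "\<exists>x. 0 < lip_dist \<alpha> p x \<and> lip_dist \<alpha> p x < \<eta>" if \<eta>: "0 < \<eta>" for \<eta>
  proof -
    define \<delta> where "\<delta> = \<eta> powr (1 / \<alpha>)"
    have "0 < \<delta>"
      using \<eta> by (simp add: \<delta>_def)
    have small: "lip_dist \<alpha> p y < \<eta>" if "y \<in> ball p \<delta>" for y
    proof -
      have "dist y p powr \<alpha> < \<delta> powr \<alpha>"
        using that pos by (intro powr_less_mono2) (auto simp: dist_commute)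
      also have "\<delta> powr \<alpha> = \<eta>"
        using \<eta> pos by (simp add: \<delta>_def powr_powr)
      finally show ?thesis
        using lip_dist_le[of p y] by linarith
    qed
    have "infinite (Y \<inter> ball p \<delta>)"
      using p \<open>0 < \<delta>\<close> by (simp add: islimpt_eq_infinite_ball)
    then obtain y z where yz: "y \<in> Y \<inter> ball p \<delta>" "z \<in> Y \<inter> ball p \<delta>" "y \<noteq> z"
      by (metis finite.emptyI is_singletonI' is_singleton_def finite.insertI)
    then obtain h where h: "h \<in> little_lip \<alpha>" "h y \<noteq> h z"
      using sep by blast
    \<comment> \<open>A function that separates \<open>y\<close> and \<open>z\<close> cannot agree
      with \<open>h p\<close> at both.\<close>
    then obtain w where w: "w \<in> ball p \<delta>" "h w \<noteq> h p"
      using yz by (metis IntD2)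
    have "lip_dist \<alpha> p w \<noteq> 0"
      using lip_dist_bound[OF h(1), of w p] w(2) by auto
    then show ?thesis
      using small[OF w(1)] lip_dist_nonneg[of p w] by (intro exI[of _ w]) simp
  qed
  with that show thesis by blast
qed

lemma not_approximately_amenable:
  fixes Y :: "'a set"
  assumes "infinite Y" and "\<And>x y. \<lbrakk>x \<in> Y; y \<in> Y; x \<noteq> y\<rbrakk> \<Longrightarrow> \<exists>h \<in> little_lip \<alpha>. h x \<noteq> h y"
  shows "\<not> approximately_amenable (little_lip_algebra \<alpha> :: ('a \<Rightarrow> complex) normed_module)"
proof -
  obtain p :: 'a where p: "\<And>\<eta>. 0 < \<eta> \<Longrightarrow> \<exists>x. 0 < lip_dist \<alpha> p x \<and> lip_dist \<alpha> p x < \<eta>"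
    using lip_dist_arbitrarily_small[OF assms] by blast
  have "\<exists>x :: nat \<Rightarrow> 'a. \<forall>n. (0 < lip_dist \<alpha> p (x n) \<and> lip_dist \<alpha> p (x n) \<le> 1) \<and>
      8 * lip_dist \<alpha> p (x (Suc n)) \<le> lip_dist \<alpha> p (x n)"
  proof (rule dependent_nat_choice)
    show "\<exists>x. 0 < lip_dist \<alpha> p x \<and> lip_dist \<alpha> p x \<le> 1"
      using p[of 1] by auto
    show "\<exists>y. (0 < lip_dist \<alpha> p y \<and> lip_dist \<alpha> p y \<le> 1) \<and> 8 * lip_dist \<alpha> p y \<le> lip_dist \<alpha> p x"
      if x: "0 < lip_dist \<alpha> p x \<and> lip_dist \<alpha> p x \<le> 1" for x
    proof -
      obtain y where "0 < lip_dist \<alpha> p y" "lip_dist \<alpha> p y < lip_dist \<alpha> p x / 8"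
        using p[of "lip_dist \<alpha> p x / 8"] x by auto
      with x show ?thesis
        by (intro exI[of _ y]) auto
    qed
  qed
  then obtain x where x: "\<And>n. 0 < lip_dist \<alpha> p (x n)" "\<And>n. lip_dist \<alpha> p (x n) \<le> 1"
    "\<And>n. 8 * lip_dist \<alpha> p (x (Suc n)) \<le> lip_dist \<alpha> p (x n)"
    by blast
  note prescribed = little_lip_prescribed_zeros[where p = p and x = x, OF x]
  obtain a where a: "a \<in> little_lip \<alpha>" "a p = 0" "\<And>n. odd n \<Longrightarrow> a (x n) = 0"
    "\<And>n. even n \<Longrightarrow> lip_dist \<alpha> p (x n) / (4 * 2 ^ n) \<le> cmod (a (x n))"
    using prescribed[of even] by blast
  obtain b where b: "b \<in> little_lip \<alpha>" "b p = 0" "\<And>n. even n \<Longrightarrow> b (x n) = 0"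
    "\<And>n. odd n \<Longrightarrow> lip_dist \<alpha> p (x n) / (4 * 2 ^ n) \<le> cmod (b (x n))"
    using prescribed[of odd] by blast
  have "\<not> approximately_amenable alg"
  proof (rule not_approximately_amenable_if_alternating[of "\<lambda>n. lip_dist \<alpha> p (x n)" x p a b])
    show "lip_dist \<alpha> p (x n) \<le> 1 / 8 ^ n" for n
    proof (induction n)
      case 0
      show ?case
        using x(2) by simp
    next
      case (Suc n)
      from order_trans[OF x(3) Suc] show ?case
        by (simp add: field_simps)
    qed
    \<comment> \<open>The estimate with the seminorm alone is weakened to the full algebra
      norm.\<close>
    show "cmod (h (x n) - h p) \<le> lip_dist \<alpha> p (x n) * ((SUP x. cmod (h x)) + lip_seminorm \<alpha> h)"
      if "h \<in> little_lip \<alpha>" for h n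
    proof -
      have "0 \<le> (SUP x. cmod (h x))"
        using cSUP_upper[OF UNIV_I bdd_above_cmod_little_lip[OF compact that]] norm_ge_zero order_trans by blast
      then have "0 \<le> lip_dist \<alpha> p (x n) * (SUP x. cmod (h x))"
        by (simp add: lip_dist_nonneg)
      with lip_dist_bound[OF that, of "x n" p] show ?thesis
        by (simp add: distrib_left)
    qed
  qed (use x a b in auto)
  then show ?thesis
    unfolding alg_eq .
qed

end

section \<open>Separated points for \<alpha> < 1 and for \<alpha> = 1\<close>

text \<open>Increments are at most \<open>dist x y\<close>, which is
  \<open>dist x y powr (1 - \<alpha>)\<close> times \<open>dist x y powr \<alpha>\<close>. The first
  factor tends to 0 since \<alpha> < 1, and \<delta> is where it reaches \<epsilon>.\<close>

lemma dist_in_little_lip: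
  fixes q :: "'a::metric_space"
  assumes X: "compact (UNIV :: 'a set)" and "0 < \<alpha>" "\<alpha> < 1"
  shows "(\<lambda>x. complex_of_real (dist x q)) \<in> little_lip \<alpha>"
  unfolding little_lip_iff[OF X assms(2)]
proof (intro allI impI)
  fix \<epsilon> :: real assume \<epsilon>: "\<epsilon> > 0"
  define \<delta> where "\<delta> = \<epsilon> powr (1 / (1 - \<alpha>))"
  have "cmod (complex_of_real (dist x q) - complex_of_real (dist y q)) \<le> \<epsilon> * dist x y powr \<alpha>"
    if "dist x y < \<delta>" for x y :: 'a
  proof (cases "x = y")
    case False
    have "dist x y powr (1 - \<alpha>) \<le> \<delta> powr (1 - \<alpha>)"
      using that assms(3) by (intro powr_mono2) auto
    also have "\<dots> = \<epsilon>"
      using \<epsilon> assms(3) by (simp add: \<delta>_def powr_powr)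
    finally have "dist x y powr (1 - \<alpha>) * dist x y powr \<alpha> \<le> \<epsilon> * dist x y powr \<alpha>"
      by (intro mult_right_mono) auto
    also have "dist x y powr (1 - \<alpha>) * dist x y powr \<alpha> = dist x y"
      using False by (simp flip: powr_add)
    finally have "dist x y \<le> \<epsilon> * dist x y powr \<alpha>" .
    moreover have "\<bar>dist x q - dist y q\<bar> \<le> dist x y"
      using abs_dist_diff_le[of x q y] by (simp add: dist_commute)
    ultimately have "\<bar>dist x q - dist y q\<bar> \<le> \<epsilon> * dist x y powr \<alpha>"
      by linarith
    then show ?thesis
      unfolding of_real_diff[symmetric] norm_of_real .
  qed simp
  moreover have "\<delta> > 0"
    using \<epsilon> by (simp add: \<delta>_def)
  ultimately show "\<exists>\<delta>>0. \<forall>x y. dist x y < \<delta> \<longrightarrow>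
      cmod (complex_of_real (dist x q) - complex_of_real (dist y q)) \<le> \<epsilon> * dist x y powr \<alpha>"
    by blast
qed

theorem theorem3p4:
  fixes \<alpha> :: real
  assumes "compact (UNIV :: 'a::metric_space set)"
    and "infinite (UNIV :: 'a set)"
    and "0 < \<alpha>" and "\<alpha> \<le> 1"
    and "\<alpha> = 1 \<Longrightarrow> \<not> finite_dimensional (little_lip_algebra \<alpha> :: ('a \<Rightarrow> complex) normed_module)"
  shows "\<not> approximately_amenable (little_lip_algebra \<alpha> :: ('a \<Rightarrow> complex) normed_module)"
proof -
  interpret compact_lip \<alpha> "TYPE('a)"
    using assms(1-3) by unfold_locales
  \<comment> \<open>For \<alpha> < 1 distance functions separate all points; for \<alpha> = 1
    infinite dimension supplies an infinite separated set.\<close>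
  have "\<exists>Y :: 'a set. infinite Y \<and>
      (\<forall>x \<in> Y. \<forall>y \<in> Y. x \<noteq> y \<longrightarrow> (\<exists>h \<in> little_lip \<alpha>. h x \<noteq> h y))"
  proof (cases "\<alpha> = 1")
    case True
    then have "\<not> finite_dimensional alg"
      using assms(5) unfolding alg_eq by blast
    then show ?thesis
      by (rule infinite_separated_set)
  next
    case False
    then have "\<exists>h \<in> little_lip \<alpha>. h x \<noteq> h y" if "x \<noteq> y" for x y :: 'a
      using dist_in_little_lip[OF assms(1,3), of y] assms(4) that
      by (intro bexI[of _ "\<lambda>z. complex_of_real (dist z y)"]) auto
    with assms(2) show ?thesis
      by (intro exI[of _ UNIV]) simp
  qed
  then obtain Y :: "'a set" where "infinite Y"
    "\<And>x y. \<lbrakk>x \<in> Y; y \<in> Y; x \<noteq> y\<rbrakk> \<Longrightarrow> \<exists>h \<in> little_lip \<alpha>. h x \<noteq> h y"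
    by metis
  then show ?thesis
    by (rule not_approximately_amenable)
qed

end
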